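(* Let $\varphi: \mathcal U^+_q \to U^+_q \otimes \mathbb F \lbrack z_1, z_2,\ldots\rbrack$ be the algebra homomorphism that sends, for all $n \in \mathbb N$, $$\mathcal W_{-n} \mapsto \sum_{k=0}^n W_{k-n} \otimes z_k,\quad \mathcal W_{n+1} \mapsto \sum_{k=0}^n W_{n+1-k} \otimes z_k,\quad \mathcal G_{n} \mapsto \sum_{k=0}^n G_{n-k} \otimes z_k,\quad \mathcal {\tilde G}_{n} \mapsto \sum_{k=0}^n \tilde G_{n-k} \otimes z_k.$$ Then for $n \in \mathbb N$ the map $\varphi$ sends $Z^\vee_n \mapsto 1 \otimes z^\vee_n$.
   Context: Let $\mathbb F$ be a field and fix a nonzero $q\in\mathbb F$ that is not a root of unity. $\mathbb N=\{0,1,2,\ldots\}$. All algebras are associative, over $\mathbb F$, with multiplicative identity; tensor products are over $\mathbb F$. For elements $X,Y$ of an algebra, $[X,Y]=XY-YX$, and $[X,Y]_q=qXY-q^{-1}YX$ (so $[X,Y]_{q^{-1}}=q^{-1}XY-qYX$). The algebra $U^+_q$ is defined by generators $A,B$ and the relations $[A,[A,[A,B]_q]_{q^{-1}}]=0$, $[B,[B,[B,A]_q]_{q^{-1}}]=0$. Its alternating elements $W_{-k}, W_{k+1}, G_{k+1}, \tilde G_{k+1}$ ($k\in\mathbb N$) are the elements determined recursively, in the order $W_0,W_1,G_1,\tilde G_1,W_{-1},W_2,G_2,\tilde G_2,W_{-2},W_3,\ldots$, by $W_0=A$, $W_1=B$, and for $n\ge 1$ $$G_n = \frac{q\sum_{k=0}^{n-1}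 W_{-k} W_{n-k} q^{n-1-2k}-\sum_{k=1}^{n-1} G_k \tilde G_{n-k} q^{n-2k}}{q^n+q^{-n}}+\frac{W_n W_0-W_0 W_n}{(1+q^{-2n})(1-q^{-2})},$$ $$\tilde G_n = G_n + \frac{W_0 W_n-W_n W_0}{1-q^{-2}},\quad W_{-n} = \frac{q W_0 G_n - q^{-1} G_n W_0}{q-q^{-1}},\quad W_{n+1} = \frac{q G_n W_1 - q^{-1} W_1 G_n}{q-q^{-1}}.$$ Also $G_0=\tilde G_0=1$. The algebra $\mathcal U^+_q$ is defined by generators (called alternating generators) $\mathcal W_{-k}, \mathcal W_{k+1}, \mathcal G_{k+1}, \mathcal{\tilde G}_{k+1}$ ($k\in\mathbb N$) and the following relations for all $k,\ell\in\mathbb N$: $[\mathcal W_0,\mathcal W_{k+1}]=[\mathcal W_{-k},\mathcal W_1]=(1-q^{-2})(\mathcal{\tilde G}_{k+1}-\mathcal G_{k+1})$; $[\mathcal W_0,\mathcal G_{k+1}]_q=[\mathcal{\tilde G}_{k+1},\mathcal W_0]_q=(q-q^{-1})\mathcal W_{-k-1}$; $[\mathcal G_{k+1},\mathcal W_1]_q=[\mathcal W_1,\mathcal{\tilde G}_{k+1}]_q=(q-q^{-1})\mathcal W_{k+2}$; $[\mathcal W_{-k},\mathcal W_{-\ell}]=0$; $[\mathcal W_{k+1},\mathcal W_{\ell+1}]=0$; $[\mathcal W_{-k},\mathcal W_{\ell+1}]+[\mathcal W_{k+1},\mathcal W_{-\ell}]=0$; $[\mathcal W_{-k},\mathcal G_{\ell+1}]+[\mathcal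 G_{k+1},\mathcal W_{-\ell}]=0$; $[\mathcal W_{-k},\mathcal{\tilde G}_{\ell+1}]+[\mathcal{\tilde G}_{k+1},\mathcal W_{-\ell}]=0$; $[\mathcal W_{k+1},\mathcal G_{\ell+1}]+[\mathcal G_{k+1},\mathcal W_{\ell+1}]=0$; $[\mathcal W_{k+1},\mathcal{\tilde G}_{\ell+1}]+[\mathcal{\tilde G}_{k+1},\mathcal W_{\ell+1}]=0$; $[\mathcal G_{k+1},\mathcal G_{\ell+1}]=0$; $[\mathcal{\tilde G}_{k+1},\mathcal{\tilde G}_{\ell+1}]=0$; $[\mathcal{\tilde G}_{k+1},\mathcal G_{\ell+1}]+[\mathcal G_{k+1},\mathcal{\tilde G}_{\ell+1}]=0$. Also $\mathcal G_0=\mathcal{\tilde G}_0=1$. $\mathbb F[z_1,z_2,\ldots]$ is the polynomial algebra in mutually commuting indeterminates $\{z_n\}_{n=1}^\infty$, and $z_0=1$. For $n\in\mathbb N$, $z^\vee_n=\sum_{k=0}^n z_kz_{n-k}q^{n-2k}$. In $\mathcal U^+_q$ define, for $n\ge1$, $Z^\vee_n=\sum_{k=0}^n\mathcal G_k\mathcal{\tilde G}_{n-k}q^{n-2k}-q\sum_{k=0}^{n-1}\mathcal W_{-k}\mathcal W_{n-k}q^{n-1-2k}$, and $Z^\vee_0=1$. The homomorphism $\varphi$ with the stated values exists (and is uniquely determined by these values). *)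

theory Defs
  imports "HOL-Library.Multiset" "HOL-Library.Poly_Mapping" "HOL-Algebra.QuotRing" "HOL-Algebra.Module"
begin

section \<open>Associative unital algebras over a field\<close>

text \<open>
  The ground field is a type of class \<open>field\<close>. An algebra over it is a record of type
  \<open>('a, 'x) module\<close>, whose ring part need not be commutative.
\<close>

definition alg_hom ::
    "('a, 'x, 'm) module_scheme \<Rightarrow> ('a, 'y, 'n) module_scheme \<Rightarrow> ('x \<Rightarrow> 'y) set" where
  "alg_hom A B =
    {h \<in> ring_hom A B. \<forall>c. \<forall>x\<in>carrier A. h (c \<odot>\<^bsub>A\<^esub> x) = c \<odot>\<^bsub>B\<^esub> h x}"

definition comm :: "('a, 'x, 'm) module_scheme \<Rightarrow> 'x \<Rightarrow> 'x \<Rightarrow> 'x" where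
  "comm A x y = x \<otimes>\<^bsub>A\<^esub> y \<ominus>\<^bsub>A\<^esub> y \<otimes>\<^bsub>A\<^esub> x"

definition qcomm :: "('a::field, 'x, 'm) module_scheme \<Rightarrow> 'a \<Rightarrow> 'x \<Rightarrow> 'x \<Rightarrow> 'x" where
  "qcomm A q x y = q \<odot>\<^bsub>A\<^esub> (x \<otimes>\<^bsub>A\<^esub> y) \<ominus>\<^bsub>A\<^esub> inverse q \<odot>\<^bsub>A\<^esub> (y \<otimes>\<^bsub>A\<^esub> x)"

definition quot_alg :: "('a, 'x, 'm) module_scheme \<Rightarrow> 'x set \<Rightarrow> ('a, 'x set) module" where
  "quot_alg A I = ring.extend (A Quot I)
     (module.fields (\<lambda>c X. \<Union>x\<in>X. I +>\<^bsub>A\<^esub> (c \<odot>\<^bsub>A\<^esub> x)))"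


subsection \<open>Monoid algebras\<close>

definition monoid_alg :: "('m, 'e) monoid_scheme \<Rightarrow> ('a::field, 'm \<Rightarrow>\<^sub>0 'a) module" where
  "monoid_alg M = \<lparr>
     carrier = {p. Poly_Mapping.keys p \<subseteq> carrier M},
     monoid.mult = (\<lambda>p r. \<Sum>x\<in>Poly_Mapping.keys p. \<Sum>y\<in>Poly_Mapping.keys r.
       Poly_Mapping.single (x \<otimes>\<^bsub>M\<^esub> y) (Poly_Mapping.lookup p x * Poly_Mapping.lookup r y)),
     one = Poly_Mapping.single \<one>\<^bsub>M\<^esub> 1,
     zero = 0,
     add = (+),
     smult = (\<lambda>c. Poly_Mapping.map ((*) c))\<rparr>"


subsection \<open>Algebras given by generators and relations\<close>

definition free_alg :: "('a::field, 'g list \<Rightarrow>\<^sub>0 'a) module" where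
  "free_alg = monoid_alg \<lparr>carrier = UNIV, monoid.mult = (@), one = []\<rparr>"

definition free_gen :: "'g \<Rightarrow> ('g list \<Rightarrow>\<^sub>0 'a::field)" where
  "free_gen g = Poly_Mapping.single [g] 1"

text \<open>A relation \<open>x = y\<close> is encoded as the pair \<open>(x, y)\<close>.\<close>

definition rel_ideal ::
    "(('g list \<Rightarrow>\<^sub>0 'a::field) \<times> ('g list \<Rightarrow>\<^sub>0 'a)) set \<Rightarrow> ('g list \<Rightarrow>\<^sub>0 'a) set" where
  "rel_ideal R = Idl\<^bsub>free_alg\<^esub> {x \<ominus>\<^bsub>free_alg\<^esub> y |x y. (x, y) \<in> R}"

definition presented_alg ::
    "(('g list \<Rightarrow>\<^sub>0 'a::field) \<times> ('g list \<Rightarrow>\<^sub>0 'a)) set \<Rightarrow> ('a, ('g list \<Rightarrow>\<^sub>0 'a) set) module" where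
  "presented_alg R = quot_alg free_alg (rel_ideal R)"

definition presented_gen ::
    "(('g list \<Rightarrow>\<^sub>0 'a::field) \<times> ('g list \<Rightarrow>\<^sub>0 'a)) set \<Rightarrow> 'g \<Rightarrow> ('g list \<Rightarrow>\<^sub>0 'a) set" where
  "presented_gen R g = rel_ideal R +>\<^bsub>free_alg\<^esub> free_gen g"


subsection \<open>Tensor products\<close>

text \<open>
  The free vector space on \<open>A \<times> B\<close>, with the product
  \<open>(x, y) (x', y') = (x x', y y')\<close> extended bilinearly, is divided by the linear span of the
  bilinearity relations. This span is an ideal, see \<open>ideal_tensor_null\<close> below.
\<close>

definition bilinear_relators ::
    "('a::field, 'x, 'm) module_scheme \<Rightarrow> ('a, 'y, 'n) module_scheme \<Rightarrow> ('x \<times> 'y \<Rightarrow>\<^sub>0 'a) set" where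
  "bilinear_relators A B = (let e = (\<lambda>x y. Poly_Mapping.single (x, y) (1::'a)) in
     {e (x \<oplus>\<^bsub>A\<^esub> x') y - e x y - e x' y |x x' y.
        x \<in> carrier A \<and> x' \<in> carrier A \<and> y \<in> carrier B} \<union>
     {e x (y \<oplus>\<^bsub>B\<^esub> y') - e x y - e x y' |x y y'.
        x \<in> carrier A \<and> y \<in> carrier B \<and> y' \<in> carrier B} \<union>
     {e (c \<odot>\<^bsub>A\<^esub> x) y - Poly_Mapping.map ((*) c) (e x y) |c x y.
        x \<in> carrier A \<and> y \<in> carrier B} \<union>
     {e x (c \<odot>\<^bsub>B\<^esub> y) - Poly_Mapping.map ((*) c) (e x y) |c x y.
        x \<in> carrier A \<and> y \<in> carrier B})"

inductive_set tensor_null ::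
    "('a::field, 'x, 'm) module_scheme \<Rightarrow> ('a, 'y, 'n) module_scheme \<Rightarrow> ('x \<times> 'y \<Rightarrow>\<^sub>0 'a) set"
  for A :: "('a::field, 'x, 'm) module_scheme" and B :: "('a, 'y, 'n) module_scheme" where
  zero: "0 \<in> tensor_null A B"
| add: "u \<in> bilinear_relators A B \<Longrightarrow> v \<in> tensor_null A B \<Longrightarrow>
    Poly_Mapping.map ((*) c) u + v \<in> tensor_null A B"

definition tensor_alg ::
    "('a::field, 'x, 'm) module_scheme \<Rightarrow> ('a, 'y, 'n) module_scheme \<Rightarrow>
     ('a, ('x \<times> 'y \<Rightarrow>\<^sub>0 'a) set) module" where
  "tensor_alg A B = quot_alg (monoid_alg (A \<times>\<times> B)) (tensor_null A B)"

definition tensor ::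
    "('a::field, 'x, 'm) module_scheme \<Rightarrow> ('a, 'y, 'n) module_scheme \<Rightarrow>
     'x \<Rightarrow> 'y \<Rightarrow> ('x \<times> 'y \<Rightarrow>\<^sub>0 'a) set" where
  "tensor A B x y = tensor_null A B +>\<^bsub>monoid_alg (A \<times>\<times> B)\<^esub> Poly_Mapping.single (x, y) 1"


section \<open>The algebra \<open>U\<^sup>+\<^sub>q\<close> and its alternating elements\<close>

datatype U_gen = Gen_A | Gen_B

type_synonym 'a U = "(U_gen list \<Rightarrow>\<^sub>0 'a) set"

definition U_relations ::
    "'a::field \<Rightarrow> ((U_gen list \<Rightarrow>\<^sub>0 'a) \<times> (U_gen list \<Rightarrow>\<^sub>0 'a)) set" where
  "U_relations q = (let F = free_alg; A = free_gen Gen_A; B = free_gen Gen_B in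
     {(comm F A (qcomm F (inverse q) A (qcomm F q A B)), \<zero>\<^bsub>F\<^esub>),
      (comm F B (qcomm F (inverse q) B (qcomm F q B A)), \<zero>\<^bsub>F\<^esub>)})"

definition U_alg :: "'a::field \<Rightarrow> ('a, 'a U) module" where
  "U_alg q = presented_alg (U_relations q)"

text \<open>
  Needed for the recursive definition below: \<open>finsum\<close> over \<open>A\<close> only inspects its summand on \<open>A\<close>.
\<close>

lemma finsum_fundef_cong [fundef_cong]:
  fixes R R' :: "('b, 'm) ring_scheme" and f g :: "'a \<Rightarrow> 'b"
  assumes "R = R'" "A = A'" "\<And>x. x \<in> A' \<Longrightarrow> f x = g x"
  shows "finsum R f A = finsum R' g A'"
proof -
  have step: "(A, z) \<in> foldSetD D (\<lambda>x. h (g x)) e"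
    if "(A, z) \<in> foldSetD D (\<lambda>x. h (f x)) e" "\<And>x. x \<in> A \<Longrightarrow> f x = g x"
    for A :: "'a set" and f g :: "'a \<Rightarrow> 'b" and h z and D :: "'b set" and e
    using that
  proof (induction A z rule: foldSetD.induct)
    case (insertI x A y)
    then have "(insert x A, h (g x) y) \<in> foldSetD D (\<lambda>x. h (g x)) e"
      by (intro foldSetD.insertI) auto
    with insertI.prems show ?case by simp
  qed (rule foldSetD.emptyI)
  have "(A, z) \<in> foldSetD D (\<lambda>x. h (f x)) e \<longleftrightarrow> (A, z) \<in> foldSetD D (\<lambda>x. h (g x)) e"
    for h :: "'b \<Rightarrow> 'b \<Rightarrow> 'b" and D e z
    using step[of A z D h f e g] step[of A z D h g e f] assms by auto
  then show ?thesis
    unfolding finsum_def finprod_def foldD_def o_def using assms by simp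
qed

text \<open>\<open>alt_W q i\<close> is \<open>W\<^sub>i\<close> for every integer \<open>i\<close>; thus \<open>W\<^sub>-\<^sub>k\<close> and \<open>W\<^sub>k\<^sub>+\<^sub>1\<close> cover all \<open>i\<close>.\<close>

function alt_W :: "'a::field \<Rightarrow> int \<Rightarrow> 'a U"
  and alt_G :: "'a \<Rightarrow> nat \<Rightarrow> 'a U"
  and alt_Gt :: "'a \<Rightarrow> nat \<Rightarrow> 'a U" where
  "alt_W q i = (let U = U_alg q in
     if i = 0 then presented_gen (U_relations q) Gen_A
     else if i = 1 then presented_gen (U_relations q) Gen_B
     else if i < 0 then let n = nat (- i) in
       (1 / (q - inverse q)) \<odot>\<^bsub>U\<^esub>
         (q \<odot>\<^bsub>U\<^esub> (alt_W q 0 \<otimes>\<^bsub>U\<^esub> alt_G q n) \<ominus>\<^bsub>U\<^esub> inverse q \<odot>\<^bsub>U\<^esub> (alt_G q n \<otimes>\<^bsub>U\<^esub> alt_W q 0))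
     else let n = nat (i - 1) in
       (1 / (q - inverse q)) \<odot>\<^bsub>U\<^esub>
         (q \<odot>\<^bsub>U\<^esub> (alt_G q n \<otimes>\<^bsub>U\<^esub> alt_W q 1) \<ominus>\<^bsub>U\<^esub> inverse q \<odot>\<^bsub>U\<^esub> (alt_W q 1 \<otimes>\<^bsub>U\<^esub> alt_G q n)))"
| "alt_G q n = (let U = U_alg q in
     if n = 0 then \<one>\<^bsub>U\<^esub>
     else
       (1 / (q ^ n + inverse q ^ n)) \<odot>\<^bsub>U\<^esub>
         (q \<odot>\<^bsub>U\<^esub> (\<Oplus>\<^bsub>U\<^esub>k\<in>{0..<n}. (q powi (int n - 1 - 2 * int k)) \<odot>\<^bsub>U\<^esub>
              (alt_W q (- int k) \<otimes>\<^bsub>U\<^esub> alt_W q (int n - int k)))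
          \<ominus>\<^bsub>U\<^esub> (\<Oplus>\<^bsub>U\<^esub>k\<in>{1..<n}. (q powi (int n - 2 * int k)) \<odot>\<^bsub>U\<^esub>
              (alt_G q k \<otimes>\<^bsub>U\<^esub> alt_Gt q (n - k))))
       \<oplus>\<^bsub>U\<^esub>
       (1 / ((1 + inverse q ^ (2 * n)) * (1 - inverse q ^ 2))) \<odot>\<^bsub>U\<^esub>
         (alt_W q (int n) \<otimes>\<^bsub>U\<^esub> alt_W q 0 \<ominus>\<^bsub>U\<^esub> alt_W q 0 \<otimes>\<^bsub>U\<^esub> alt_W q (int n)))"
| "alt_Gt q n = (let U = U_alg q in
     if n = 0 then \<one>\<^bsub>U\<^esub>
     else
       alt_G q n \<oplus>\<^bsub>U\<^esub> (1 / (1 - inverse q ^ 2)) \<odot>\<^bsub>U\<^esub>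
         (alt_W q 0 \<otimes>\<^bsub>U\<^esub> alt_W q (int n) \<ominus>\<^bsub>U\<^esub> alt_W q (int n) \<otimes>\<^bsub>U\<^esub> alt_W q 0))"
  by pat_completeness simp_all
termination
  by (relation "measure (\<lambda>s. case s of
        Inl (q, i) \<Rightarrow> if i \<le> 0 then 4 * nat (- i) else 4 * nat (i - 1) + 1
      | Inr (Inl (q, n)) \<Rightarrow> 4 * n - 2
      | Inr (Inr (q, n)) \<Rightarrow> 4 * n - 1)") auto

declare alt_W.simps [simp del] alt_G.simps [simp del] alt_Gt.simps [simp del]


section \<open>The algebra \<open>\<U>\<^sup>+\<^sub>q\<close>\<close>

text \<open>
  \<open>Gen_W i\<close> is \<open>\<W>\<^sub>i\<close> for every integer \<open>i\<close>, whereas \<open>Gen_G k\<close> and \<open>Gen_Gt k\<close> carry the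
  index \<open>k + 1\<close>, since \<open>\<G>\<^sub>0\<close> is not a generator.
\<close>

datatype cU_gen = Gen_W int | Gen_G nat | Gen_Gt nat

type_synonym 'a cU = "(cU_gen list \<Rightarrow>\<^sub>0 'a) set"

definition cU_relations ::
    "'a::field \<Rightarrow> ((cU_gen list \<Rightarrow>\<^sub>0 'a) \<times> (cU_gen list \<Rightarrow>\<^sub>0 'a)) set" where
  "cU_relations q = (let
       F = free_alg;
       Wm = (\<lambda>k. free_gen (Gen_W (- int k)));
       Wp = (\<lambda>k. free_gen (Gen_W (int k + 1)));
       G = (\<lambda>k. free_gen (Gen_G k));
       Gt = (\<lambda>k. free_gen (Gen_Gt k))
     in \<Union>k l. {
       (comm F (Wm 0) (Wp k), (1 - inverse q ^ 2) \<odot>\<^bsub>F\<^esub> (Gt k \<ominus>\<^bsub>F\<^esub> G k)),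
       (comm F (Wm k) (Wp 0), (1 - inverse q ^ 2) \<odot>\<^bsub>F\<^esub> (Gt k \<ominus>\<^bsub>F\<^esub> G k)),
       (qcomm F q (Wm 0) (G k), (q - inverse q) \<odot>\<^bsub>F\<^esub> Wm (k + 1)),
       (qcomm F q (Gt k) (Wm 0), (q - inverse q) \<odot>\<^bsub>F\<^esub> Wm (k + 1)),
       (qcomm F q (G k) (Wp 0), (q - inverse q) \<odot>\<^bsub>F\<^esub> Wp (k + 1)),
       (qcomm F q (Wp 0) (Gt k), (q - inverse q) \<odot>\<^bsub>F\<^esub> Wp (k + 1)),
       (comm F (Wm k) (Wm l), \<zero>\<^bsub>F\<^esub>),
       (comm F (Wp k) (Wp l), \<zero>\<^bsub>F\<^esub>),
       (comm F (Wm k) (Wp l) \<oplus>\<^bsub>F\<^esub> comm F (Wp k) (Wm l), \<zero>\<^bsub>F\<^esub>),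
       (comm F (Wm k) (G l) \<oplus>\<^bsub>F\<^esub> comm F (G k) (Wm l), \<zero>\<^bsub>F\<^esub>),
       (comm F (Wm k) (Gt l) \<oplus>\<^bsub>F\<^esub> comm F (Gt k) (Wm l), \<zero>\<^bsub>F\<^esub>),
       (comm F (Wp k) (G l) \<oplus>\<^bsub>F\<^esub> comm F (G k) (Wp l), \<zero>\<^bsub>F\<^esub>),
       (comm F (Wp k) (Gt l) \<oplus>\<^bsub>F\<^esub> comm F (Gt k) (Wp l), \<zero>\<^bsub>F\<^esub>),
       (comm F (G k) (G l), \<zero>\<^bsub>F\<^esub>),
       (comm F (Gt k) (Gt l), \<zero>\<^bsub>F\<^esub>),
       (comm F (Gt k) (G l) \<oplus>\<^bsub>F\<^esub> comm F (G k) (Gt l), \<zero>\<^bsub>F\<^esub>)})"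

definition cU_alg :: "'a::field \<Rightarrow> ('a, 'a cU) module" where
  "cU_alg q = presented_alg (cU_relations q)"

definition cal_W :: "'a::field \<Rightarrow> int \<Rightarrow> 'a cU" where
  "cal_W q i = presented_gen (cU_relations q) (Gen_W i)"

definition cal_G :: "'a::field \<Rightarrow> nat \<Rightarrow> 'a cU" where
  "cal_G q n = (if n = 0 then \<one>\<^bsub>cU_alg q\<^esub> else presented_gen (cU_relations q) (Gen_G (n - 1)))"

definition cal_Gt :: "'a::field \<Rightarrow> nat \<Rightarrow> 'a cU" where
  "cal_Gt q n = (if n = 0 then \<one>\<^bsub>cU_alg q\<^esub> else presented_gen (cU_relations q) (Gen_Gt (n - 1)))"

definition Z_check :: "'a::field \<Rightarrow> nat \<Rightarrow> 'a cU" where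
  "Z_check q n = (let U = cU_alg q in
     if n = 0 then \<one>\<^bsub>U\<^esub>
     else
       (\<Oplus>\<^bsub>U\<^esub>k\<in>{0..n}. (q powi (int n - 2 * int k)) \<odot>\<^bsub>U\<^esub> (cal_G q k \<otimes>\<^bsub>U\<^esub> cal_Gt q (n - k)))
       \<ominus>\<^bsub>U\<^esub> q \<odot>\<^bsub>U\<^esub> (\<Oplus>\<^bsub>U\<^esub>k\<in>{0..<n}. (q powi (int n - 1 - 2 * int k)) \<odot>\<^bsub>U\<^esub>
           (cal_W q (- int k) \<otimes>\<^bsub>U\<^esub> cal_W q (int n - int k))))"


section \<open>The polynomial algebra in \<open>z\<^sub>1, z\<^sub>2, \<dots>\<close>\<close>

text \<open>
  A monomial is the multiset of the indices of its indeterminates. Only positive indices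
  occur, since \<open>z\<^sub>0 = 1\<close> is not an indeterminate.
\<close>

type_synonym 'a zpoly = "nat multiset \<Rightarrow>\<^sub>0 'a"

definition zpoly_alg :: "('a::field, 'a zpoly) module" where
  "zpoly_alg = monoid_alg \<lparr>carrier = {M. 0 \<notin># M}, monoid.mult = (+), one = {#}\<rparr>"

definition z :: "nat \<Rightarrow> 'a::field zpoly" where
  "z n = (if n = 0 then \<one>\<^bsub>zpoly_alg\<^esub> else Poly_Mapping.single {#n#} 1)"

definition z_check :: "'a::field \<Rightarrow> nat \<Rightarrow> 'a zpoly" where
  "z_check q n = (let P = zpoly_alg in
     \<Oplus>\<^bsub>P\<^esub>k\<in>{0..n}. (q powi (int n - 2 * int k)) \<odot>\<^bsub>P\<^esub> (z k \<otimes>\<^bsub>P\<^esub> z (n - k)))"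


subsection \<open>The algebra \<open>U\<^sup>+\<^sub>q \<otimes> \<F>[z\<^sub>1, z\<^sub>2, \<dots>]\<close>\<close>

abbreviation UZ_alg :: "'a::field \<Rightarrow> ('a, ('a U \<times> 'a zpoly \<Rightarrow>\<^sub>0 'a) set) module" where
  "UZ_alg q \<equiv> tensor_alg (U_alg q) zpoly_alg"

abbreviation UZ_tensor :: "'a::field \<Rightarrow> 'a U \<Rightarrow> 'a zpoly \<Rightarrow> ('a U \<times> 'a zpoly \<Rightarrow>\<^sub>0 'a) set" where
  "UZ_tensor q \<equiv> tensor (U_alg q) zpoly_alg"


section \<open>The constructions are algebras\<close>

locale assoc_alg = ring A for A :: "('a::field, 'x, 'm) module_scheme" (structure) +
  assumes smult_closed: "x \<in> carrier A \<Longrightarrow> c \<odot> x \<in> carrier A"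
    and smult_add: "x \<in> carrier A \<Longrightarrow> y \<in> carrier A \<Longrightarrow> c \<odot> (x \<oplus> y) = c \<odot> x \<oplus> c \<odot> y"
    and add_smult: "x \<in> carrier A \<Longrightarrow> (c + d) \<odot> x = c \<odot> x \<oplus> d \<odot> x"
    and smult_smult: "x \<in> carrier A \<Longrightarrow> c \<odot> (d \<odot> x) = (c * d) \<odot> x"
    and one_smult: "x \<in> carrier A \<Longrightarrow> 1 \<odot> x = x"
    and smult_mult: "x \<in> carrier A \<Longrightarrow> y \<in> carrier A \<Longrightarrow> (c \<odot> x) \<otimes> y = c \<odot> (x \<otimes> y)"
    and mult_smult: "x \<in> carrier A \<Longrightarrow> y \<in> carrier A \<Longrightarrow> x \<otimes> (c \<odot> y) = c \<odot> (x \<otimes> y)"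


subsection \<open>Monoid algebras\<close>

lemma monoid_alg_mult:
  assumes "finite S" "finite T" "Poly_Mapping.keys p \<subseteq> S" "Poly_Mapping.keys r \<subseteq> T"
  shows "p \<otimes>\<^bsub>monoid_alg M\<^esub> r = (\<Sum>x\<in>S. \<Sum>y\<in>T.
    Poly_Mapping.single (x \<otimes>\<^bsub>M\<^esub> y) (Poly_Mapping.lookup p x * Poly_Mapping.lookup r y))"
proof -
  have "p \<otimes>\<^bsub>monoid_alg M\<^esub> r = (\<Sum>x\<in>Poly_Mapping.keys p. \<Sum>y\<in>T.
    Poly_Mapping.single (x \<otimes>\<^bsub>M\<^esub> y) (Poly_Mapping.lookup p x * Poly_Mapping.lookup r y))"
    unfolding monoid_alg_def monoid.simps using assms(2,4)
    by (intro sum.cong refl sum.mono_neutral_left) (auto simp: in_keys_iff)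
  also have "\<dots> = (\<Sum>x\<in>S. \<Sum>y\<in>T.
    Poly_Mapping.single (x \<otimes>\<^bsub>M\<^esub> y) (Poly_Mapping.lookup p x * Poly_Mapping.lookup r y))"
    using assms by (intro sum.mono_neutral_left) (auto simp: in_keys_iff)
  finally show ?thesis .
qed

lemma monoid_alg_l_distr:
  "(p + p') \<otimes>\<^bsub>monoid_alg M\<^esub> r = p \<otimes>\<^bsub>monoid_alg M\<^esub> r + p' \<otimes>\<^bsub>monoid_alg M\<^esub> r"
proof -
  let ?S = "Poly_Mapping.keys p \<union> Poly_Mapping.keys p'" and ?T = "Poly_Mapping.keys r"
  have "Poly_Mapping.keys (p + p') \<subseteq> ?S" by (rule Poly_Mapping.keys_add)
  then show ?thesis
    by (simp add: monoid_alg_mult[of ?S ?T] lookup_add distrib_right single_add sum.distrib)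
qed

lemma monoid_alg_r_distr:
  "r \<otimes>\<^bsub>monoid_alg M\<^esub> (p + p') = r \<otimes>\<^bsub>monoid_alg M\<^esub> p + r \<otimes>\<^bsub>monoid_alg M\<^esub> p'"
proof -
  let ?S = "Poly_Mapping.keys p \<union> Poly_Mapping.keys p'" and ?T = "Poly_Mapping.keys r"
  have "Poly_Mapping.keys (p + p') \<subseteq> ?S" by (rule Poly_Mapping.keys_add)
  then show ?thesis
    by (simp add: monoid_alg_mult[of ?T ?S] lookup_add distrib_left single_add sum.distrib)
qed

lemma monoid_alg_mult_0 [simp]:
  "0 \<otimes>\<^bsub>monoid_alg M\<^esub> r = 0" "r \<otimes>\<^bsub>monoid_alg M\<^esub> 0 = 0"
  by (simp_all add: monoid_alg_def)

lemma monoid_alg_mult_sum: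
  "(\<Sum>i\<in>I. f i) \<otimes>\<^bsub>monoid_alg M\<^esub> r = (\<Sum>i\<in>I. f i \<otimes>\<^bsub>monoid_alg M\<^esub> r)"
  "r \<otimes>\<^bsub>monoid_alg M\<^esub> (\<Sum>i\<in>I. f i) = (\<Sum>i\<in>I. r \<otimes>\<^bsub>monoid_alg M\<^esub> f i)"
  by (induction I rule: infinite_finite_induct)
    (simp_all add: monoid_alg_l_distr monoid_alg_r_distr)

lemma monoid_alg_single_l:
  "Poly_Mapping.single x a \<otimes>\<^bsub>monoid_alg M\<^esub> r =
    (\<Sum>y\<in>Poly_Mapping.keys r. Poly_Mapping.single (x \<otimes>\<^bsub>M\<^esub> y) (a * Poly_Mapping.lookup r y))"
  by (subst monoid_alg_mult[of "{x}" "Poly_Mapping.keys r"]) auto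

lemma monoid_alg_single_r:
  "r \<otimes>\<^bsub>monoid_alg M\<^esub> Poly_Mapping.single y a =
    (\<Sum>x\<in>Poly_Mapping.keys r. Poly_Mapping.single (x \<otimes>\<^bsub>M\<^esub> y) (Poly_Mapping.lookup r x * a))"
  by (subst monoid_alg_mult[of "Poly_Mapping.keys r" "{y}"]) auto

lemma monoid_alg_single_single:
  "Poly_Mapping.single x a \<otimes>\<^bsub>monoid_alg M\<^esub> Poly_Mapping.single y b =
    Poly_Mapping.single (x \<otimes>\<^bsub>M\<^esub> y) (a * b)"
  by (subst monoid_alg_mult[of "{x}" "{y}"]) auto

lemma keys_sum_subset:
  assumes "\<And>i. i \<in> I \<Longrightarrow> Poly_Mapping.keys (f i) \<subseteq> S"
  shows "Poly_Mapping.keys (\<Sum>i\<in>I. f i) \<subseteq> S"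
  using assms
proof (induction I rule: infinite_finite_induct)
  case (insert i I)
  then have "Poly_Mapping.keys (f i) \<union> Poly_Mapping.keys (\<Sum>i\<in>I. f i) \<subseteq> S" by auto
  then have "Poly_Mapping.keys (f i + (\<Sum>i\<in>I. f i)) \<subseteq> S"
    by (rule order_trans[OF Poly_Mapping.keys_add])
  then show ?case using insert.hyps by simp
qed auto

lemma sum_single_lookup:
  "(\<Sum>x\<in>Poly_Mapping.keys p. Poly_Mapping.single x (Poly_Mapping.lookup p x)) = p"
  by (rule poly_mapping_eqI)
    (simp add: lookup_sum lookup_single when_def in_keys_iff sum.delta')

lemma ring_monoid_alg:
  assumes "monoid M"
  shows "ring (monoid_alg M :: ('a::field, 'm \<Rightarrow>\<^sub>0 'a) module)"
proof -
  interpret M: monoid M by fact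
  let ?A = "monoid_alg M :: ('a, 'm \<Rightarrow>\<^sub>0 'a) module"
  have mem: "p \<in> carrier ?A \<longleftrightarrow> Poly_Mapping.keys p \<subseteq> carrier M" for p
    by (simp add: monoid_alg_def)
  have ops: "p \<oplus>\<^bsub>?A\<^esub> r = p + r" "\<zero>\<^bsub>?A\<^esub> = 0" "\<one>\<^bsub>?A\<^esub> = Poly_Mapping.single \<one>\<^bsub>M\<^esub> 1" for p r
    by (simp_all add: monoid_alg_def)
  show ?thesis
  proof (rule ringI)
    show "abelian_group ?A"
    proof (rule abelian_groupI)
      fix p r assume *: "p \<in> carrier ?A" "r \<in> carrier ?A"
      then show "p \<oplus>\<^bsub>?A\<^esub> r \<in> carrier ?A"
        using Poly_Mapping.keys_add[of p r] by (auto simp: mem ops)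
    next
      fix p assume "p \<in> carrier ?A"
      then show "\<exists>r\<in>carrier ?A. r \<oplus>\<^bsub>?A\<^esub> p = \<zero>\<^bsub>?A\<^esub>"
        by (intro bexI[of _ "- p"]) (auto simp: mem ops)
    qed (auto simp: mem ops algebra_simps)
    show "monoid ?A"
    proof (rule monoidI)
      fix p r assume *: "p \<in> carrier ?A" "r \<in> carrier ?A"
      have "Poly_Mapping.keys (p \<otimes>\<^bsub>?A\<^esub> r) \<subseteq> carrier M"
        unfolding monoid_alg_mult[of "Poly_Mapping.keys p" "Poly_Mapping.keys r" p r, simplified]
        by (intro keys_sum_subset) (use * in \<open>auto simp: mem split: if_splits\<close>)
      then show "p \<otimes>\<^bsub>?A\<^esub> r \<in> carrier ?A" by (simp add: mem)
    next
      fix p r s assume *: "p \<in> carrier ?A" "r \<in> carrier ?A" "s \<in> carrier ?A"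
      have e: "u \<otimes>\<^bsub>?A\<^esub> v = (\<Sum>x\<in>Poly_Mapping.keys u. \<Sum>y\<in>Poly_Mapping.keys v.
        Poly_Mapping.single (x \<otimes>\<^bsub>M\<^esub> y) (Poly_Mapping.lookup u x * Poly_Mapping.lookup v y))" for u v
        by (rule monoid_alg_mult) auto
      have "(p \<otimes>\<^bsub>?A\<^esub> r) \<otimes>\<^bsub>?A\<^esub> s = (\<Sum>x\<in>Poly_Mapping.keys p. \<Sum>y\<in>Poly_Mapping.keys r.
          \<Sum>t\<in>Poly_Mapping.keys s. Poly_Mapping.single (x \<otimes>\<^bsub>M\<^esub> y \<otimes>\<^bsub>M\<^esub> t)
            (Poly_Mapping.lookup p x * Poly_Mapping.lookup r y * Poly_Mapping.lookup s t))"
        by (simp only: e[of p r] monoid_alg_mult_sum monoid_alg_single_l)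
      also have "\<dots> = (\<Sum>x\<in>Poly_Mapping.keys p. \<Sum>y\<in>Poly_Mapping.keys r.
          \<Sum>t\<in>Poly_Mapping.keys s. Poly_Mapping.single (x \<otimes>\<^bsub>M\<^esub> (y \<otimes>\<^bsub>M\<^esub> t))
            (Poly_Mapping.lookup p x * (Poly_Mapping.lookup r y * Poly_Mapping.lookup s t)))"
      proof (intro sum.cong refl)
        fix x y t
        assume "x \<in> Poly_Mapping.keys p" "y \<in> Poly_Mapping.keys r" "t \<in> Poly_Mapping.keys s"
        with * have "x \<in> carrier M" "y \<in> carrier M" "t \<in> carrier M" by (auto simp: mem)
        then show "Poly_Mapping.single (x \<otimes>\<^bsub>M\<^esub> y \<otimes>\<^bsub>M\<^esub> t)
            (Poly_Mapping.lookup p x * Poly_Mapping.lookup r y * Poly_Mapping.lookup s t) =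
          Poly_Mapping.single (x \<otimes>\<^bsub>M\<^esub> (y \<otimes>\<^bsub>M\<^esub> t))
            (Poly_Mapping.lookup p x * (Poly_Mapping.lookup r y * Poly_Mapping.lookup s t))"
          by (simp add: M.m_assoc mult.assoc)
      qed
      also have "\<dots> = (\<Sum>x\<in>Poly_Mapping.keys p.
          Poly_Mapping.single x (Poly_Mapping.lookup p x) \<otimes>\<^bsub>?A\<^esub> (r \<otimes>\<^bsub>?A\<^esub> s))"
        by (simp only: e[of r s] monoid_alg_mult_sum monoid_alg_single_single)
      also have "\<dots> = p \<otimes>\<^bsub>?A\<^esub> (r \<otimes>\<^bsub>?A\<^esub> s)"
        by (simp only: monoid_alg_mult_sum(1)[symmetric] sum_single_lookup)
      finally show "(p \<otimes>\<^bsub>?A\<^esub> r) \<otimes>\<^bsub>?A\<^esub> s = p \<otimes>\<^bsub>?A\<^esub> (r \<otimes>\<^bsub>?A\<^esub> s)" .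
    next
      fix p assume *: "p \<in> carrier ?A"
      have "\<one>\<^bsub>?A\<^esub> \<otimes>\<^bsub>?A\<^esub> p =
          (\<Sum>y\<in>Poly_Mapping.keys p. Poly_Mapping.single y (Poly_Mapping.lookup p y))"
        using * by (auto simp: ops monoid_alg_single_l mem subset_iff intro!: sum.cong)
      then show "\<one>\<^bsub>?A\<^esub> \<otimes>\<^bsub>?A\<^esub> p = p" by (simp add: sum_single_lookup)
      have "p \<otimes>\<^bsub>?A\<^esub> \<one>\<^bsub>?A\<^esub> =
          (\<Sum>y\<in>Poly_Mapping.keys p. Poly_Mapping.single y (Poly_Mapping.lookup p y))"
        using * by (auto simp: ops monoid_alg_single_r mem subset_iff intro!: sum.cong)
      then show "p \<otimes>\<^bsub>?A\<^esub> \<one>\<^bsub>?A\<^esub> = p" by (simp add: sum_single_lookup)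
    qed (auto simp: mem ops)
  qed (simp_all add: ops monoid_alg_l_distr monoid_alg_r_distr)
qed

lemma lookup_scale:
  "Poly_Mapping.lookup (Poly_Mapping.map ((*) c) p) x = c * Poly_Mapping.lookup p x"
  for c :: "'a::field"
  by (cases "Poly_Mapping.lookup p x = 0") (simp_all add: Poly_Mapping.map.rep_eq)

lemma keys_scale: "Poly_Mapping.keys (Poly_Mapping.map ((*) c) p) \<subseteq> Poly_Mapping.keys p"
  for c :: "'a::field"
  by (auto simp: in_keys_iff lookup_scale)

lemma scale_single:
  "Poly_Mapping.map ((*) c) (Poly_Mapping.single x d) = Poly_Mapping.single x (c * d)"
  for c :: "'a::field"
  by (rule poly_mapping_eqI) (simp add: lookup_scale lookup_single when_def)

lemma scale_add:
  "Poly_Mapping.map ((*) c) (p + r) = Poly_Mapping.map ((*) c) p + Poly_Mapping.map ((*) c) r"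
  for c :: "'a::field"
  by (rule poly_mapping_eqI) (simp add: lookup_scale lookup_add algebra_simps)

lemma scale_diff:
  "Poly_Mapping.map ((*) c) (p - r) = Poly_Mapping.map ((*) c) p - Poly_Mapping.map ((*) c) r"
  for c :: "'a::field"
  by (rule poly_mapping_eqI) (simp add: lookup_scale lookup_minus algebra_simps)

lemma scale_0 [simp]: "Poly_Mapping.map ((*) c) 0 = 0"
  for c :: "'a::field"
  by (rule poly_mapping_eqI) (simp add: lookup_scale)

lemma scale_scale:
  "Poly_Mapping.map ((*) c) (Poly_Mapping.map ((*) d) p) = Poly_Mapping.map ((*) (c * d)) p"
  for c :: "'a::field"
  by (rule poly_mapping_eqI) (simp add: lookup_scale algebra_simps)

lemma scale_1: "Poly_Mapping.map ((*) 1) p = p"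
  for p :: "'m \<Rightarrow>\<^sub>0 'a::field"
  by (rule poly_mapping_eqI) (simp add: lookup_scale)

lemma scale_uminus_1: "Poly_Mapping.map ((*) (- 1)) p = - p"
  for p :: "'m \<Rightarrow>\<^sub>0 'a::field"
  by (rule poly_mapping_eqI) (simp add: lookup_scale)

lemma scale_sum:
  "Poly_Mapping.map ((*) c) (\<Sum>i\<in>I. f i) = (\<Sum>i\<in>I. Poly_Mapping.map ((*) c) (f i))"
  for c :: "'a::field"
  by (induction I rule: infinite_finite_induct) (simp_all add: scale_add)

lemma monoid_alg_scale_mult:
  fixes c :: "'a::field" and p r :: "'m \<Rightarrow>\<^sub>0 'a"
  shows "Poly_Mapping.map ((*) c) p \<otimes>\<^bsub>monoid_alg M\<^esub> r =
      Poly_Mapping.map ((*) c) (p \<otimes>\<^bsub>monoid_alg M\<^esub> r)"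
    and "p \<otimes>\<^bsub>monoid_alg M\<^esub> Poly_Mapping.map ((*) c) r =
      Poly_Mapping.map ((*) c) (p \<otimes>\<^bsub>monoid_alg M\<^esub> r)"
proof -
  have *: "Poly_Mapping.map ((*) c) (p \<otimes>\<^bsub>monoid_alg M\<^esub> r) =
      (\<Sum>x\<in>Poly_Mapping.keys p. \<Sum>y\<in>Poly_Mapping.keys r. Poly_Mapping.single (x \<otimes>\<^bsub>M\<^esub> y)
        (c * (Poly_Mapping.lookup p x * Poly_Mapping.lookup r y)))"
    by (simp only: monoid_alg_mult[OF finite_keys finite_keys order_refl order_refl]
        scale_sum scale_single)
  show "Poly_Mapping.map ((*) c) p \<otimes>\<^bsub>monoid_alg M\<^esub> r =
      Poly_Mapping.map ((*) c) (p \<otimes>\<^bsub>monoid_alg M\<^esub> r)"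
    unfolding * monoid_alg_mult[OF finite_keys finite_keys keys_scale order_refl]
    by (simp only: lookup_scale mult.assoc)
  show "p \<otimes>\<^bsub>monoid_alg M\<^esub> Poly_Mapping.map ((*) c) r =
      Poly_Mapping.map ((*) c) (p \<otimes>\<^bsub>monoid_alg M\<^esub> r)"
    unfolding * monoid_alg_mult[OF finite_keys finite_keys order_refl keys_scale]
    by (simp only: lookup_scale mult.left_commute)
qed

lemma assoc_alg_monoid_alg:
  assumes "monoid M"
  shows "assoc_alg (monoid_alg M :: ('a::field, 'm \<Rightarrow>\<^sub>0 'a) module)"
proof -
  let ?A = "monoid_alg M :: ('a, 'm \<Rightarrow>\<^sub>0 'a) module"
  have ops: "p \<oplus>\<^bsub>?A\<^esub> r = p + r" "c \<odot>\<^bsub>?A\<^esub> r = Poly_Mapping.map ((*) c) r"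
    "p \<in> carrier ?A \<longleftrightarrow> Poly_Mapping.keys p \<subseteq> carrier M" for p r c
    by (simp_all add: monoid_alg_def)
  have "c \<odot>\<^bsub>?A\<^esub> x \<in> carrier ?A" if "x \<in> carrier ?A" for c x
    using that keys_scale[of c x] by (auto simp: ops)
  moreover have "(c + d) \<odot>\<^bsub>?A\<^esub> x = c \<odot>\<^bsub>?A\<^esub> x \<oplus>\<^bsub>?A\<^esub> d \<odot>\<^bsub>?A\<^esub> x" for c d x
    by (rule poly_mapping_eqI) (simp add: ops lookup_scale lookup_add distrib_right)
  moreover have "c \<odot>\<^bsub>?A\<^esub> (x \<oplus>\<^bsub>?A\<^esub> y) = c \<odot>\<^bsub>?A\<^esub> x \<oplus>\<^bsub>?A\<^esub> c \<odot>\<^bsub>?A\<^esub> y" for c x y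
    by (simp only: ops scale_add)
  moreover have "c \<odot>\<^bsub>?A\<^esub> (d \<odot>\<^bsub>?A\<^esub> x) = (c * d) \<odot>\<^bsub>?A\<^esub> x" for c d x
    by (simp only: ops scale_scale)
  moreover have "1 \<odot>\<^bsub>?A\<^esub> x = x" for x
    by (simp only: ops scale_1)
  moreover have "(c \<odot>\<^bsub>?A\<^esub> x) \<otimes>\<^bsub>?A\<^esub> y = c \<odot>\<^bsub>?A\<^esub> (x \<otimes>\<^bsub>?A\<^esub> y)" for c x y
    by (simp only: ops monoid_alg_scale_mult)
  moreover have "x \<otimes>\<^bsub>?A\<^esub> (c \<odot>\<^bsub>?A\<^esub> y) = c \<odot>\<^bsub>?A\<^esub> (x \<otimes>\<^bsub>?A\<^esub> y)" for c x y
    by (simp only: ops monoid_alg_scale_mult)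
  ultimately show ?thesis
    unfolding assoc_alg_def assoc_alg_axioms_def using ring_monoid_alg[OF assms] by simp
qed


subsection \<open>Quotients\<close>

lemma (in assoc_alg) ideal_smult:
  assumes "ideal I A" "i \<in> I"
  shows "c \<odot> i \<in> I"
proof -
  interpret I: ideal I A by fact
  have i: "i \<in> carrier A" using assms(2) I.a_subset by blast
  then have "c \<odot> i = (c \<odot> \<one>) \<otimes> i" by (simp add: smult_mult)
  also have "\<dots> \<in> I" using assms(2) by (intro I.I_l_closed smult_closed) auto
  finally show ?thesis .
qed

lemma quot_alg_simps:
  "carrier (quot_alg A I) = carrier (A Quot I)"
  "mult (quot_alg A I) = mult (A Quot I)"
  "one (quot_alg A I) = one (A Quot I)"
  "zero (quot_alg A I) = zero (A Quot I)"
  "add (quot_alg A I) = add (A Quot I)"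
  "smult (quot_alg A I) = (\<lambda>c X. \<Union>x\<in>X. I +>\<^bsub>A\<^esub> (c \<odot>\<^bsub>A\<^esub> x))"
  by (simp_all add: quot_alg_def ring.extend_def module.fields_def)

lemma (in assoc_alg) quot_alg_smult:
  assumes "ideal I A" "x \<in> carrier A"
  shows "c \<odot>\<^bsub>quot_alg A I\<^esub> (I +> x) = I +> (c \<odot> x)"
proof -
  interpret I: ideal I A by fact
  have "I +> (c \<odot> y) = I +> (c \<odot> x)" if y: "y \<in> I +> x" for y
  proof -
    obtain i where i: "i \<in> I" "y = i \<oplus> x"
      using y by (auto simp: a_r_coset_def r_coset_def)
    have "i \<in> carrier A" using i(1) I.a_subset by blast
    then have "c \<odot> y = c \<odot> i \<oplus> c \<odot> x" using i assms(2) by (simp add: smult_add)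
    moreover have "c \<odot> i \<in> I" using assms(1) i(1) by (rule ideal_smult)
    ultimately have "c \<odot> y \<in> I +> (c \<odot> x)" by (auto simp: a_r_coset_def r_coset_def)
    then show ?thesis
      using a_repr_independence[OF _ smult_closed[OF assms(2)] I.a_subgroup] by simp
  qed
  moreover have "x \<in> I +> x" using assms(2) by (rule I.a_rcos_self)
  ultimately show ?thesis
    unfolding quot_alg_simps by blast
qed

lemma (in assoc_alg) assoc_alg_quot_alg:
  assumes "ideal I A"
  shows "assoc_alg (quot_alg A I)"
proof -
  interpret I: ideal I A by fact
  let ?Q = "quot_alg A I"
  interpret Q: ring "A Quot I" by (rule I.quotient_is_ring)
  have r: "ring ?Q"
  proof (rule ringI)
    show "abelian_group ?Q"
      by (rule abelian_groupI; unfold quot_alg_simps)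
        (auto simp: Q.a_ac intro: Q.l_neg)
    show "monoid ?Q"
      by (rule monoidI; unfold quot_alg_simps) (auto simp: Q.m_assoc)
  qed (auto simp: quot_alg_simps Q.l_distr Q.r_distr)
  have carr: "X \<in> carrier ?Q \<longleftrightarrow> (\<exists>x\<in>carrier A. X = I +> x)" for X
    by (auto simp: quot_alg_simps FactRing_def A_RCOSETS_def')
  have add: "(I +> x) \<oplus>\<^bsub>?Q\<^esub> (I +> y) = I +> (x \<oplus> y)"
    if "x \<in> carrier A" "y \<in> carrier A" for x y
    using that by (simp add: quot_alg_simps FactRing_def I.a_rcos_sum)
  have mult: "(I +> x) \<otimes>\<^bsub>?Q\<^esub> (I +> y) = I +> (x \<otimes> y)"
    if "x \<in> carrier A" "y \<in> carrier A" for x y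
    using that by (simp add: quot_alg_simps FactRing_def I.rcoset_mult_add)
  note facts = add mult quot_alg_smult[OF assms] smult_closed smult_add add_smult smult_smult
    one_smult smult_mult mult_smult
  show ?thesis
    unfolding assoc_alg_def assoc_alg_axioms_def
  proof (intro conjI r allI impI)
  qed (auto simp: carr facts intro: smult_closed)
qed

lemma assoc_alg_presented_alg:
  fixes R :: "(('g list \<Rightarrow>\<^sub>0 'a::field) \<times> ('g list \<Rightarrow>\<^sub>0 'a)) set"
  assumes "\<And>x y. (x, y) \<in> R \<Longrightarrow> x \<in> carrier free_alg \<and> y \<in> carrier free_alg"
  shows "assoc_alg (presented_alg R)"
proof -
  let ?F = "free_alg :: ('a, 'g list \<Rightarrow>\<^sub>0 'a) module"
  interpret assoc_alg ?F
    unfolding free_alg_def by (intro assoc_alg_monoid_alg monoidI) auto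
  have "ideal (rel_ideal R) ?F"
    unfolding rel_ideal_def using assms by (intro genideal_ideal) auto
  then show ?thesis
    unfolding presented_alg_def by (rule assoc_alg_quot_alg)
qed

lemma free_alg_carrier: "x \<in> carrier free_alg"
  by (simp add: free_alg_def monoid_alg_def)

lemma assoc_alg_U_alg: "assoc_alg (U_alg q)"
  unfolding U_alg_def by (rule assoc_alg_presented_alg) (simp add: free_alg_carrier)

lemma assoc_alg_cU_alg: "assoc_alg (cU_alg q)"
  unfolding cU_alg_def by (rule assoc_alg_presented_alg) (simp add: free_alg_carrier)

lemma assoc_alg_zpoly_alg: "assoc_alg zpoly_alg"
  unfolding zpoly_alg_def by (intro assoc_alg_monoid_alg monoidI) auto


subsection \<open>Tensor products\<close>

lemma tensor_null_scale:
  "u \<in> tensor_null A B \<Longrightarrow> Poly_Mapping.map ((*) c) u \<in> tensor_null A B"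
proof (induction rule: tensor_null.induct)
  case (add u v d)
  then show ?case
    using tensor_null.add[of u A B "Poly_Mapping.map ((*) c) v" "c * d"]
    by (simp add: scale_add scale_scale)
qed (simp add: tensor_null.zero)

lemma tensor_null_add:
  "u \<in> tensor_null A B \<Longrightarrow> v \<in> tensor_null A B \<Longrightarrow> u + v \<in> tensor_null A B"
proof (induction rule: tensor_null.induct)
  case (add u w d)
  then show ?case using tensor_null.add[of u A B "w + v" d] by (simp add: add.assoc)
qed simp

lemma tensor_null_sum:
  "(\<And>i. i \<in> I \<Longrightarrow> f i \<in> tensor_null A B) \<Longrightarrow> (\<Sum>i\<in>I. f i) \<in> tensor_null A B"
  by (induction I rule: infinite_finite_induct)
    (auto intro: tensor_null.zero tensor_null_add)

lemma tensor_null_relator: "u \<in> bilinear_relators A B \<Longrightarrow> u \<in> tensor_null A B"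
  using tensor_null.add[of u A B 0 1] by (simp add: tensor_null.zero scale_1)

lemma monoid_alg_diff_distr:
  "(p - p') \<otimes>\<^bsub>monoid_alg M\<^esub> r = p \<otimes>\<^bsub>monoid_alg M\<^esub> r - p' \<otimes>\<^bsub>monoid_alg M\<^esub> r"
  "r \<otimes>\<^bsub>monoid_alg M\<^esub> (p - p') = r \<otimes>\<^bsub>monoid_alg M\<^esub> p - r \<otimes>\<^bsub>monoid_alg M\<^esub> p'"
  using monoid_alg_l_distr[where r = r and p = "p - p'" and p' = p' and M = M] monoid_alg_r_distr[where r = r and p = "p - p'" and p' = p' and M = M] by simp_all

lemma bilinear_relators_cases [consumes 1, case_names add_l add_r scale_l scale_r]:
  fixes A :: "('a::field, 'x, 'm) module_scheme" and B :: "('a, 'y, 'n) module_scheme"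
  assumes "u \<in> bilinear_relators A B"
  obtains
    x x' y where "x \<in> carrier A" "x' \<in> carrier A" "y \<in> carrier B"
      "u = Poly_Mapping.single (x \<oplus>\<^bsub>A\<^esub> x', y) 1 - Poly_Mapping.single (x, y) 1
        - Poly_Mapping.single (x', y) 1"
  | x y y' where "x \<in> carrier A" "y \<in> carrier B" "y' \<in> carrier B"
      "u = Poly_Mapping.single (x, y \<oplus>\<^bsub>B\<^esub> y') 1 - Poly_Mapping.single (x, y) 1
        - Poly_Mapping.single (x, y') 1"
  | c x y where "x \<in> carrier A" "y \<in> carrier B"
      "u = Poly_Mapping.single (c \<odot>\<^bsub>A\<^esub> x, y) 1 - Poly_Mapping.single (x, y) c"
  | c x y where "x \<in> carrier A" "y \<in> carrier B"
      "u = Poly_Mapping.single (x, c \<odot>\<^bsub>B\<^esub> y) 1 - Poly_Mapping.single (x, y) c"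
  using assms unfolding bilinear_relators_def Let_def scale_single mult_1_right by blast

lemma ideal_tensor_null:
  fixes A :: "('a::field, 'x, 'm) module_scheme" and B :: "('a, 'y, 'n) module_scheme"
  assumes "assoc_alg A" "assoc_alg B"
  shows "ideal (tensor_null A B) (monoid_alg (A \<times>\<times> B))"
proof -
  interpret A: assoc_alg A by fact
  interpret B: assoc_alg B by fact
  let ?P = "monoid_alg (A \<times>\<times> B)" and ?N = "tensor_null A B"
  have mon: "monoid (A \<times>\<times> B)"
    by (rule DirProd_monoid) (rule A.monoid_axioms B.monoid_axioms)+
  interpret P: assoc_alg ?P by (rule assoc_alg_monoid_alg[OF mon])
  have carr: "u \<in> carrier ?P \<longleftrightarrow> Poly_Mapping.keys u \<subseteq> carrier A \<times> carrier B" for u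
    by (simp add: monoid_alg_def DirProd_def)
  have ops: "u \<oplus>\<^bsub>?P\<^esub> v = u + v" "\<zero>\<^bsub>?P\<^esub> = 0" for u v
    by (simp_all add: monoid_alg_def)
  have kd: "Poly_Mapping.keys (u - v) \<subseteq> S"
    if "Poly_Mapping.keys u \<subseteq> S" "Poly_Mapping.keys v \<subseteq> S"
    for u v :: "('x \<times> 'y) \<Rightarrow>\<^sub>0 'a" and S
    using that keys_diff[of u v] by blast
  have rel: "Poly_Mapping.keys u \<subseteq> carrier A \<times> carrier B" if "u \<in> bilinear_relators A B" for u
    using that
    by (cases rule: bilinear_relators_cases; simp only:; intro kd)
      (auto simp: A.smult_closed B.smult_closed split: if_splits)
  have sub: "?N \<subseteq> carrier ?P"
  proof
    fix u assume "u \<in> ?N"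
    then show "u \<in> carrier ?P"
    proof induction
      case (add u v c)
      then show ?case
        using rel[of u] keys_scale[of c u] Poly_Mapping.keys_add[of "Poly_Mapping.map ((*) c) u" v]
        by (auto simp: carr)
    qed (simp add: carr)
  qed
  have prod: "(x, y) \<otimes>\<^bsub>A \<times>\<times> B\<^esub> (x', y') = (x \<otimes>\<^bsub>A\<^esub> x', y \<otimes>\<^bsub>B\<^esub> y')" for x y x' y'
    by (simp add: DirProd_def)
  have r1: "Poly_Mapping.single (x \<oplus>\<^bsub>A\<^esub> x', y) 1 - Poly_Mapping.single (x, y) 1
      - Poly_Mapping.single (x', y) 1 \<in> ?N"
    if "x \<in> carrier A" "x' \<in> carrier A" "y \<in> carrier B" for x x' y
    using that by (intro tensor_null_relator) (auto simp: bilinear_relators_def)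
  have r2: "Poly_Mapping.single (x, y \<oplus>\<^bsub>B\<^esub> y') 1 - Poly_Mapping.single (x, y) 1
      - Poly_Mapping.single (x, y') 1 \<in> ?N"
    if "x \<in> carrier A" "y \<in> carrier B" "y' \<in> carrier B" for x y y'
    using that by (intro tensor_null_relator) (auto simp: bilinear_relators_def)
  have r3: "Poly_Mapping.single (c \<odot>\<^bsub>A\<^esub> x, y) 1 - Poly_Mapping.single (x, y) c \<in> ?N"
    if "x \<in> carrier A" "y \<in> carrier B" for c x y
    using that by (intro tensor_null_relator)
      (auto simp: bilinear_relators_def scale_single)
  have r4: "Poly_Mapping.single (x, c \<odot>\<^bsub>B\<^esub> y) 1 - Poly_Mapping.single (x, y) c \<in> ?N"
    if "x \<in> carrier A" "y \<in> carrier B" for c x y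
    using that by (intro tensor_null_relator)
      (auto simp: bilinear_relators_def scale_single)
  note rs = r1 r2 r3 r4
  have l1: "Poly_Mapping.single (a, b) 1 \<otimes>\<^bsub>?P\<^esub> u \<in> ?N"
    if u: "u \<in> bilinear_relators A B" and ab: "a \<in> carrier A" "b \<in> carrier B" for a b u
    using u
    by (cases rule: bilinear_relators_cases)
      (use ab in \<open>simp_all add: monoid_alg_diff_distr monoid_alg_single_single prod
        A.r_distr B.r_distr A.mult_smult B.mult_smult rs\<close>)
  have r1': "u \<otimes>\<^bsub>?P\<^esub> Poly_Mapping.single (a, b) 1 \<in> ?N"
    if u: "u \<in> bilinear_relators A B" and ab: "a \<in> carrier A" "b \<in> carrier B" for a b u
    using u
    by (cases rule: bilinear_relators_cases)
      (use ab in \<open>simp_all add: monoid_alg_diff_distr monoid_alg_single_single prod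
        A.l_distr B.l_distr A.smult_mult B.smult_mult rs\<close>)
  have L: "p \<otimes>\<^bsub>?P\<^esub> u \<in> ?N" and R: "u \<otimes>\<^bsub>?P\<^esub> p \<in> ?N"
    if u: "u \<in> ?N" and p: "p \<in> carrier ?P" for p u
  proof -
    have e: "p = (\<Sum>x\<in>Poly_Mapping.keys p.
        Poly_Mapping.map ((*) (Poly_Mapping.lookup p x)) (Poly_Mapping.single x 1))"
      using sum_single_lookup[of p] by (simp add: scale_single)
    have l: "Poly_Mapping.single x 1 \<otimes>\<^bsub>?P\<^esub> u \<in> ?N" and r: "u \<otimes>\<^bsub>?P\<^esub> Poly_Mapping.single x 1 \<in> ?N"
      if key: "x \<in> Poly_Mapping.keys p" for x
    proof -
      obtain a b where x: "x = (a, b)" "a \<in> carrier A" "b \<in> carrier B"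
        using key p by (cases x) (auto simp: carr)
      show "Poly_Mapping.single x 1 \<otimes>\<^bsub>?P\<^esub> u \<in> ?N"
        using u
      proof induction
        case (add u v c)
        then show ?case
          using l1[of u a b] x
          by (auto simp: monoid_alg_r_distr monoid_alg_scale_mult
              intro!: tensor_null_add tensor_null_scale)
      qed (simp add: tensor_null.zero)
      show "u \<otimes>\<^bsub>?P\<^esub> Poly_Mapping.single x 1 \<in> ?N"
        using u
      proof induction
        case (add u v c)
        then show ?case
          using r1'[of u a b] x
          by (auto simp: monoid_alg_l_distr monoid_alg_scale_mult
              intro!: tensor_null_add tensor_null_scale)
      qed (simp add: tensor_null.zero)
    qed
    show "p \<otimes>\<^bsub>?P\<^esub> u \<in> ?N"
      by (subst e) (auto simp only: monoid_alg_mult_sum monoid_alg_scale_mult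
          intro!: tensor_null_sum tensor_null_scale l)
    show "u \<otimes>\<^bsub>?P\<^esub> p \<in> ?N"
      by (subst e) (auto simp only: monoid_alg_mult_sum monoid_alg_scale_mult
          intro!: tensor_null_sum tensor_null_scale r)
  qed
  show ?thesis
  proof (rule idealI)
    show "ring ?P" by (rule P.ring_axioms)
    show "subgroup ?N (add_monoid ?P)"
    proof (rule group.subgroupI)
      show "group (add_monoid ?P)" by (rule P.add.group_axioms)
      show "?N \<subseteq> carrier (add_monoid ?P)" using sub by simp
      show "?N \<noteq> {}" using tensor_null.zero by blast
      fix u assume u: "u \<in> ?N"
      have "\<ominus>\<^bsub>?P\<^esub> u = - u"
      proof (rule P.minus_equality)
        show "- u \<oplus>\<^bsub>?P\<^esub> u = \<zero>\<^bsub>?P\<^esub>" by (simp add: ops)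
        show uP: "u \<in> carrier ?P" using u sub by blast
        then show "- u \<in> carrier ?P" by (simp add: carr)
      qed
      then show "inv\<^bsub>add_monoid ?P\<^esub> u \<in> ?N"
        using tensor_null_scale[OF u, of "- 1"] by (simp add: scale_uminus_1 a_inv_def)
    next
      fix u v assume "u \<in> ?N" "v \<in> ?N"
      then show "u \<otimes>\<^bsub>add_monoid ?P\<^esub> v \<in> ?N" by (simp add: ops tensor_null_add)
    qed
  qed (use L R in auto)
qed

lemma assoc_alg_tensor_alg:
  assumes "assoc_alg A" "assoc_alg B"
  shows "assoc_alg (tensor_alg A B)"
proof -
  interpret A: assoc_alg A by fact
  interpret B: assoc_alg B by fact
  have "monoid (A \<times>\<times> B)"
    by (rule DirProd_monoid) (rule A.monoid_axioms B.monoid_axioms)+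
  then show ?thesis
    unfolding tensor_alg_def
    using assoc_alg.assoc_alg_quot_alg[OF assoc_alg_monoid_alg ideal_tensor_null[OF assms]] by blast
qed

end

theory Submission
  imports Defs "HOL-Algebra.UnivPoly"
begin

text \<open>
  For sequences \<open>x\<close>, \<open>y\<close> in an algebra put \<open>(x \<ast>\<^sub>q y)\<^sub>n = \<Sum>\<^sub>k q\<^bsup>n-2k\<^esup> x\<^sub>k y\<^sub>n\<^sub>-\<^sub>k\<close>. This is the coefficient of
  \<open>t\<^sup>n\<close> in \<open>X(q\<^sup>-\<^sup>1t) Y(qt)\<close>, where \<open>X\<close>, \<open>Y\<close> are the generating functions of \<open>x\<close>, \<open>y\<close>. With
  \<open>W\<^sup>-\<^sub>k = W\<^sub>-\<^sub>k\<close>, and \<open>W\<^sup>+\<^sub>k = W\<^sub>k\<close> for \<open>k > 0\<close> but \<open>W\<^sup>+\<^sub>0 = 0\<close>, all the objects in question have this form: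
  \<open>Z\<^sup>\<or>\<close> is \<open>\<G> \<ast>\<^sub>q \<G>~ - \<W>\<^sup>- \<ast>\<^sub>q \<W>\<^sup>+\<close>, and \<open>z\<^sup>\<or>\<close> is \<open>z \<ast>\<^sub>q z\<close>.
  
  The values of \<open>\<phi>\<close> say that \<open>\<phi>\<close> multiplies each of the four generating functions by \<open>z(t) = \<Sum>\<^sub>k z\<^sub>k t\<^sup>k\<close>,
  for instance \<open>\<G>(t) \<mapsto> G(t) \<otimes> z(t)\<close>. Since \<open>1 \<otimes> z(t)\<close> commutes with \<open>U \<otimes> 1\<close>, it can be pulled out of
  a product (lemma \<open>qconv_interchange\<close>), so that the generating function of \<open>Z\<^sup>\<or>\<close> is sent to
  \<open>(G(q\<^sup>-\<^sup>1t) G~(qt) - W\<^sup>-(q\<^sup>-\<^sup>1t) W\<^sup>+(qt)) \<otimes> z(q\<^sup>-\<^sup>1t) z(qt)\<close>.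
  
  The first factor is \<open>1\<close>: its constant term is \<open>G\<^sub>0 G~\<^sub>0 = 1\<close>, and its coefficients in positive degree vanish (lemma
  \<open>alternating_quadratic_relation\<close>), because the recursion for \<open>G\<^sub>n\<close> is exactly this vanishing, solved
  for \<open>G\<^sub>n\<close> after the elimination of \<open>G~\<^sub>n\<close>. The second factor is the generating function of \<open>z\<^sup>\<or>\<close>.
\<close>

section \<open>Convolution of sequences in a ring\<close>

definition conv :: "('b, 'm) ring_scheme \<Rightarrow> (nat \<Rightarrow> 'b) \<Rightarrow> (nat \<Rightarrow> 'b) \<Rightarrow> nat \<Rightarrow> 'b" where
  "conv R x y n = (\<Oplus>\<^bsub>R\<^esub>k\<in>{..n}. x k \<otimes>\<^bsub>R\<^esub> y (n - k))"

context ring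
begin

lemma conv_closed [simp]:
  "range x \<subseteq> carrier R \<Longrightarrow> range y \<subseteq> carrier R \<Longrightarrow> conv R x y n \<in> carrier R"
  unfolding conv_def by (intro finsum_closed) (auto simp: range_subsetD)

text \<open>
  The double sum over \<open>i + j \<le> n\<close>, arranged by diagonals on the left and by rows on the right. The
  induction adds one diagonal, which lengthens each row by one entry.
\<close>

lemma finsum_triangle_swap:
  fixes f :: "nat \<Rightarrow> nat \<Rightarrow> 'a"
  assumes f: "\<And>i j. f i j \<in> carrier R"
  shows "(\<Oplus>k\<in>{..n}. \<Oplus>i\<in>{..k}. f i (k - i)) = (\<Oplus>i\<in>{..n}. \<Oplus>j\<in>{..n - i}. f i j)"
proof (induction n)
  case (Suc n)
  have "(\<Oplus>i\<in>{..n}. \<Oplus>j\<in>{..Suc n - i}. f i j)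
      = (\<Oplus>i\<in>{..n}. f i (Suc n - i) \<oplus> (\<Oplus>j\<in>{..n - i}. f i j))"
    by (rule finsum_cong') (auto simp: f Suc_diff_le)
  also have "\<dots> = (\<Oplus>i\<in>{..n}. f i (Suc n - i)) \<oplus> (\<Oplus>i\<in>{..n}. \<Oplus>j\<in>{..n - i}. f i j)"
    by (rule finsum_addf) (auto simp: f)
  finally show ?case
    using Suc by (simp add: f a_assoc Pi_def)
qed (simp add: f)

lemma conv_assoc:
  assumes x: "range x \<subseteq> carrier R" and y: "range y \<subseteq> carrier R" and w: "range w \<subseteq> carrier R"
  shows "conv R (conv R x y) w = conv R x (conv R y w)"
proof
  fix n
  have c: "x i \<in> carrier R" "y i \<in> carrier R" "w i \<in> carrier R" for i
    using assms by auto
  have "conv R (conv R x y) w n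
      = (\<Oplus>k\<in>{..n}. \<Oplus>i\<in>{..k}. x i \<otimes> y (k - i) \<otimes> w (n - i - (k - i)))"
    unfolding conv_def
    by (rule finsum_cong') (auto simp: c finsum_ldistr intro!: finsum_cong')
  also have "\<dots> = (\<Oplus>i\<in>{..n}. \<Oplus>j\<in>{..n - i}. x i \<otimes> y j \<otimes> w (n - i - j))"
    by (rule finsum_triangle_swap[where f = "\<lambda>i j. x i \<otimes> y j \<otimes> w (n - i - j)"]) (simp add: c)
  also have "\<dots> = conv R x (conv R y w) n"
    unfolding conv_def
    by (rule finsum_cong') (auto simp: c finsum_rdistr m_assoc)
  finally show "conv R (conv R x y) w n = conv R x (conv R y w) n" .
qed

lemma conv_commute:
  assumes x: "range x \<subseteq> carrier R" and y: "range y \<subseteq> carrier R"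
    and xy: "\<And>i j. x i \<otimes> y j = y j \<otimes> x i"
  shows "conv R x y = conv R y x"
proof
  fix n
  have c: "x i \<in> carrier R" "y i \<in> carrier R" for i
    using assms by auto
  have "conv R x y n = (\<Oplus>k\<in>{..n}. y (n - k) \<otimes> x (n - (n - k)))"
    unfolding conv_def by (rule finsum_cong') (auto simp: c xy)
  also have "\<dots> = (\<Oplus>k\<in>(\<lambda>k. n - k) ` {..n}. y k \<otimes> x (n - k))"
    by (rule finsum_reindex[symmetric]) (auto simp: c inj_on_def)
  also have "(\<lambda>k. n - k) ` {..n} = {..n}"
  proof (intro equalityI subsetI)
    show "k \<in> (\<lambda>k. n - k) ` {..n}" if "k \<in> {..n}" for k
      using that by (intro image_eqI[of _ _ "n - k"]) auto
  qed auto
  finally show "conv R x y n = conv R y x n"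
    unfolding conv_def .
qed

text \<open>
  Associativity moves \<open>s\<close> next to \<open>y\<close>, where the two may be exchanged: in terms of generating
  functions, \<open>(XS)(YT) = (XY)(ST)\<close> when the coefficients of \<open>S\<close> and \<open>Y\<close> commute.
\<close>

lemma conv_interchange:
  assumes "range x \<subseteq> carrier R" "range s \<subseteq> carrier R" "range y \<subseteq> carrier R" "range t \<subseteq> carrier R"
    and "\<And>i j. s i \<otimes> y j = y j \<otimes> s i"
  shows "conv R (conv R x s) (conv R y t) = conv R (conv R x y) (conv R s t)"
proof -
  have c: "range (conv R a b) \<subseteq> carrier R" if "range a \<subseteq> carrier R" "range b \<subseteq> carrier R" for a b
    using that by auto
  have "conv R (conv R x s) (conv R y t) = conv R x (conv R (conv R s y) t)"
    by (simp only: assms c conv_assoc)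
  also have "conv R s y = conv R y s"
    by (rule conv_commute) (use assms in auto)
  also have "conv R x (conv R (conv R y s) t) = conv R (conv R x y) (conv R s t)"
    by (simp only: assms c conv_assoc)
  finally show ?thesis .
qed

lemma conv_minus_left:
  assumes x: "range x \<subseteq> carrier R" and x': "range x' \<subseteq> carrier R" and y: "range y \<subseteq> carrier R"
  shows "conv R x y n \<ominus> conv R x' y n = conv R (\<lambda>k. x k \<ominus> x' k) y n"
proof -
  have c: "x i \<in> carrier R" "x' i \<in> carrier R" "y i \<in> carrier R" for i
    using assms by auto
  have "conv R (\<lambda>k. x k \<ominus> x' k) y n \<oplus> conv R x' y n
    = (\<Oplus>k\<in>{..n}. (x k \<ominus> x' k) \<otimes> y (n - k) \<oplus> x' k \<otimes> y (n - k))"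
    unfolding conv_def by (rule finsum_addf[symmetric]) (auto simp: c)
  also have "\<dots> = conv R x y n"
    unfolding conv_def
    by (rule finsum_cong') (auto simp: c minus_eq l_distr l_minus a_assoc l_neg)
  finally have e: "conv R x y n = conv R (\<lambda>k. x k \<ominus> x' k) y n \<oplus> conv R x' y n" by simp
  have "conv R (\<lambda>k. x k \<ominus> x' k) y n \<in> carrier R" "conv R x' y n \<in> carrier R"
    using c by (auto intro!: conv_closed)
  then show ?thesis
    unfolding e by (simp add: minus_eq a_assoc r_neg)
qed

lemma conv_unit_left:
  assumes x: "x 0 = \<one>" "\<And>k. k > 0 \<Longrightarrow> x k = \<zero>" and y: "range y \<subseteq> carrier R"
  shows "conv R x y n = y n"
proof -
  have c: "y i \<in> carrier R" for i
    using assms by auto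
  have "conv R x y n = (\<Oplus>k\<in>{..n}. if 0 = k then y n else \<zero>)"
    unfolding conv_def by (rule finsum_cong') (auto simp: c x)
  also have "\<dots> = y n"
    by (rule finsum_singleton) (auto simp: c)
  finally show ?thesis .
qed

end


section \<open>The \<open>q\<close>-weighted convolution\<close>

definition qconv ::
    "('a::field, 'b, 'm) module_scheme \<Rightarrow> 'a \<Rightarrow> (nat \<Rightarrow> 'b) \<Rightarrow> (nat \<Rightarrow> 'b) \<Rightarrow> nat \<Rightarrow> 'b" where
  "qconv A q x y n =
    (\<Oplus>\<^bsub>A\<^esub>k\<in>{..n}. (q powi (int n - 2 * int k)) \<odot>\<^bsub>A\<^esub> (x k \<otimes>\<^bsub>A\<^esub> y (n - k)))"

context assoc_alg
begin

lemma smult_zero [simp]: "c \<odot> \<zero> = \<zero>"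
  using mult_smult[of \<zero> \<zero> c] by (simp add: smult_closed)

lemma finsum_smult:
  assumes "\<And>i. i \<in> I \<Longrightarrow> f i \<in> carrier A"
  shows "c \<odot> (\<Oplus>i\<in>I. f i) = (\<Oplus>i\<in>I. c \<odot> f i)"
  using assms
  by (induction I rule: infinite_finite_induct) (auto simp: Pi_def smult_add smult_closed)

lemma qconv_closed [simp]:
  "range x \<subseteq> carrier A \<Longrightarrow> range y \<subseteq> carrier A \<Longrightarrow> qconv A q x y n \<in> carrier A"
  unfolding qconv_def by (intro finsum_closed) (auto intro!: smult_closed simp: range_subsetD)

text \<open>
  Since \<open>q\<^bsup>n-2k\<^esup> = q\<^bsup>-k\<^esup> q\<^bsup>n-k\<^esup>\<close>, the weight splits between the two factors. This is the substitution
  \<open>t \<mapsto> q\<^sup>-\<^sup>1t\<close> in the left and \<open>t \<mapsto> qt\<close> in the right generating function, and \<open>conv_scale\<close> below says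
  that such substitutions respect products.
\<close>

lemma qconv_eq_conv:
  assumes q: "q \<noteq> 0" and x: "range x \<subseteq> carrier A" and y: "range y \<subseteq> carrier A"
  shows "qconv A q x y n = conv A (\<lambda>k. inverse q ^ k \<odot> x k) (\<lambda>k. q ^ k \<odot> y k) n"
proof -
  have c: "x i \<in> carrier A" "y i \<in> carrier A" for i
    using assms by auto
  have w: "q powi (int n - 2 * int k) = inverse q ^ k * q ^ (n - k)" if "k \<le> n" for k
  proof -
    have e: "int n - 2 * int k = int (n - k) - int k" using that by simp
    have "q powi (int n - 2 * int k) = q ^ (n - k) / q ^ k"
      unfolding e using q power_int_diff[of q "int (n - k)" "int k"]
      by (simp only: power_int_of_nat simp_thms)
    then show ?thesis
      by (simp only: divide_inverse power_inverse mult.commute)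
  qed
  show ?thesis
    unfolding qconv_def conv_def
  proof (rule finsum_cong')
    fix k assume "k \<in> {..n}"
    then have k: "k \<le> n" by simp
    show "q powi (int n - 2 * int k) \<odot> (x k \<otimes> y (n - k))
        = (inverse q ^ k \<odot> x k) \<otimes> (q ^ (n - k) \<odot> y (n - k))"
      unfolding w[OF k]
      by (simp only: smult_mult mult_smult smult_smult smult_closed m_closed c mult.commute)
  qed (auto simp: c smult_closed)
qed

lemma conv_scale:
  assumes x: "range x \<subseteq> carrier A" and y: "range y \<subseteq> carrier A"
  shows "c ^ n \<odot> conv A x y n = conv A (\<lambda>k. c ^ k \<odot> x k) (\<lambda>k. c ^ k \<odot> y k) n"
proof -
  have c: "x i \<in> carrier A" "y i \<in> carrier A" for i
    using assms by auto
  have "c ^ n \<odot> conv A x y n = (\<Oplus>k\<in>{..n}. c ^ n \<odot> (x k \<otimes> y (n - k)))"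
    unfolding conv_def by (rule finsum_smult) (simp add: c)
  also have "\<dots> = conv A (\<lambda>k. c ^ k \<odot> x k) (\<lambda>k. c ^ k \<odot> y k) n"
    unfolding conv_def
  proof (rule finsum_cong')
    fix k assume "k \<in> {..n}"
    then have "c ^ n = c ^ k * c ^ (n - k)"
      by (simp flip: power_add)
    then show "c ^ n \<odot> (x k \<otimes> y (n - k)) = (c ^ k \<odot> x k) \<otimes> (c ^ (n - k) \<odot> y (n - k))"
      by (simp only: smult_mult mult_smult smult_smult smult_closed m_closed c mult.commute)
  qed (auto simp: c smult_closed)
  finally show ?thesis .
qed

lemma qconv_interchange:
  assumes q: "q \<noteq> 0"
    and x: "range x \<subseteq> carrier A" and s: "range s \<subseteq> carrier A"
    and y: "range y \<subseteq> carrier A" and t: "range t \<subseteq> carrier A"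
    and sy: "\<And>i j. s i \<otimes> y j = y j \<otimes> s i"
  shows "qconv A q (conv A x s) (conv A y t) n = conv A (qconv A q x y) (qconv A q s t) n"
proof -
  have c: "x i \<in> carrier A" "y i \<in> carrier A" "s i \<in> carrier A" "t i \<in> carrier A" for i
    using assms by auto
  have "qconv A q (conv A x s) (conv A y t) n =
    conv A (\<lambda>k. inverse q ^ k \<odot> conv A x s k) (\<lambda>k. q ^ k \<odot> conv A y t k) n"
    by (rule qconv_eq_conv) (use assms in auto)
  also have "\<dots> = conv A
      (conv A (\<lambda>k. inverse q ^ k \<odot> x k) (\<lambda>k. inverse q ^ k \<odot> s k))
      (conv A (\<lambda>k. q ^ k \<odot> y k) (\<lambda>k. q ^ k \<odot> t k)) n"
    by (simp only: conv_scale[OF x s] conv_scale[OF y t])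
  also have "\<dots> = conv A
      (conv A (\<lambda>k. inverse q ^ k \<odot> x k) (\<lambda>k. q ^ k \<odot> y k))
      (conv A (\<lambda>k. inverse q ^ k \<odot> s k) (\<lambda>k. q ^ k \<odot> t k)) n"
  proof (subst conv_interchange)
    show "(inverse q ^ i \<odot> s i) \<otimes> (q ^ j \<odot> y j) = (q ^ j \<odot> y j) \<otimes> (inverse q ^ i \<odot> s i)" for i j
      by (simp only: smult_mult mult_smult smult_smult smult_closed m_closed c sy mult.commute)
  qed (auto simp: c smult_closed)
  also have "\<dots> = conv A (qconv A q x y) (qconv A q s t) n"
    by (simp only: qconv_eq_conv[OF q x y, abs_def] qconv_eq_conv[OF q s t, abs_def])
  finally show ?thesis .
qed

text \<open>
  The \<open>W\<close>-sums run over \<open>k < n\<close> only, with exponent \<open>n - 1 - 2k\<close>. The prefactor \<open>q\<close> corrects the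
  exponent, and replacing \<open>y\<^sub>0\<close> by zero supplies the missing term \<open>k = n\<close>.
\<close>

lemma smult_finsum_shift:
  fixes n :: nat
  assumes q: "q \<noteq> 0" and x: "range x \<subseteq> carrier A" and y: "\<And>k. k > 0 \<Longrightarrow> y k \<in> carrier A"
  shows "q \<odot> (\<Oplus>k\<in>{0..<n}. (q powi (int n - 1 - 2 * int k)) \<odot> (x k \<otimes> y (n - k)))
    = qconv A q x (y(0 := \<zero>)) n"
proof -
  have c: "x i \<in> carrier A" for i
    using assms by auto
  have w: "q * q powi (int n - 1 - 2 * int k) = q powi (int n - 2 * int k)" for k
    using power_int_add_1'[of q "int n - 1 - 2 * int k"] q by simp
  have "q \<odot> (\<Oplus>k\<in>{0..<n}. (q powi (int n - 1 - 2 * int k)) \<odot> (x k \<otimes> y (n - k)))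
      = (\<Oplus>k\<in>{0..<n}. q \<odot> ((q powi (int n - 1 - 2 * int k)) \<odot> (x k \<otimes> y (n - k))))"
    by (rule finsum_smult) (auto simp: c y smult_closed)
  also have "\<dots> = (\<Oplus>k\<in>{..<n}. (q powi (int n - 2 * int k)) \<odot> (x k \<otimes> (y(0 := \<zero>)) (n - k)))"
    by (rule finsum_cong') (auto simp: c y smult_closed smult_smult w)
  also have "\<dots> = qconv A q x (y(0 := \<zero>)) n"
    unfolding qconv_def lessThan_Suc_atMost[symmetric] lessThan_Suc
    by (subst finsum_insert) (auto simp: c y smult_closed)
  finally show ?thesis .
qed

end


section \<open>Algebra homomorphisms preserve convolutions\<close>

locale alg_homomorphism = A?: assoc_alg A + B?: assoc_alg B
  for A :: "('a::field, 'x, 'm) module_scheme" and B :: "('a, 'y, 'n) module_scheme" +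
  fixes h
  assumes alg_hom: "h \<in> alg_hom A B"

sublocale alg_homomorphism \<subseteq> ring_hom_ring A B h
  using alg_hom by unfold_locales (simp add: alg_hom_def)

context alg_homomorphism
begin

lemma hom_smult: "x \<in> carrier A \<Longrightarrow> h (c \<odot>\<^bsub>A\<^esub> x) = c \<odot>\<^bsub>B\<^esub> h x"
  using alg_hom by (simp add: alg_hom_def)

lemma hom_minus:
  "x \<in> carrier A \<Longrightarrow> y \<in> carrier A \<Longrightarrow> h (x \<ominus>\<^bsub>A\<^esub> y) = h x \<ominus>\<^bsub>B\<^esub> h y"
  by (simp add: A.minus_eq B.minus_eq)

lemma hom_qconv:
  assumes "range x \<subseteq> carrier A" "range y \<subseteq> carrier A"
  shows "h (qconv A q x y n) = qconv B q (\<lambda>k. h (x k)) (\<lambda>k. h (y k)) n"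
proof -
  have c: "x i \<in> carrier A" "y i \<in> carrier A" for i
    using assms by auto
  show ?thesis
    unfolding qconv_def
    by (subst hom_finsum)
      (auto simp: c A.smult_closed B.smult_closed hom_smult intro!: B.finsum_cong')
qed

end


section \<open>The two embeddings into a tensor product\<close>

locale alg_pair = A?: assoc_alg A + B?: assoc_alg B
  for A :: "('a::field, 'x, 'm) module_scheme" and B :: "('a, 'y, 'n) module_scheme"
begin

abbreviation pure (infixl "\<star>" 75) where "x \<star> y \<equiv> tensor A B x y"

abbreviation T where "T \<equiv> tensor_alg A B"

sublocale T: assoc_alg T
  by (rule assoc_alg_tensor_alg) unfold_locales

sublocale P: assoc_alg "monoid_alg (A \<times>\<times> B) :: ('a, 'x \<times> 'y \<Rightarrow>\<^sub>0 'a) module"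
  by (intro assoc_alg_monoid_alg DirProd_monoid) unfold_locales

sublocale N: ideal "tensor_null A B" "monoid_alg (A \<times>\<times> B)"
  by (rule ideal_tensor_null) unfold_locales

lemma single_carrier:
  "x \<in> carrier A \<Longrightarrow> y \<in> carrier B \<Longrightarrow>
    Poly_Mapping.single (x, y) c \<in> carrier (monoid_alg (A \<times>\<times> B))"
  by (simp add: monoid_alg_def DirProd_def)

lemma pure_closed: "x \<in> carrier A \<Longrightarrow> y \<in> carrier B \<Longrightarrow> x \<star> y \<in> carrier T"
  using single_carrier[of x y 1]
  by (auto simp: tensor_def tensor_alg_def quot_alg_simps FactRing_def A_RCOSETS_def')

lemma pure_mult:
  assumes "x \<in> carrier A" "y \<in> carrier B" "x' \<in> carrier A" "y' \<in> carrier B"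
  shows "(x \<star> y) \<otimes>\<^bsub>T\<^esub> (x' \<star> y') = (x \<otimes>\<^bsub>A\<^esub> x') \<star> (y \<otimes>\<^bsub>B\<^esub> y')"
proof -
  have "(x \<star> y) \<otimes>\<^bsub>T\<^esub> (x' \<star> y') = tensor_null A B +>\<^bsub>monoid_alg (A \<times>\<times> B)\<^esub>
      (Poly_Mapping.single (x, y) 1 \<otimes>\<^bsub>monoid_alg (A \<times>\<times> B)\<^esub> Poly_Mapping.single (x', y') 1)"
    using assms
    by (simp add: tensor_def tensor_alg_def quot_alg_simps FactRing_def N.rcoset_mult_add
        single_carrier)
  then show ?thesis
    by (simp add: monoid_alg_single_single tensor_def DirProd_def)
qed

lemma pure_one: "\<one>\<^bsub>A\<^esub> \<star> \<one>\<^bsub>B\<^esub> = \<one>\<^bsub>T\<^esub>"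
  by (simp add: tensor_def tensor_alg_def quot_alg_simps FactRing_def monoid_alg_def DirProd_def)

text \<open>
  Reduces each bilinearity law of \<open>\<star>\<close> below to the membership of a single bilinear relator.
\<close>

lemma coset_eqI:
  assumes u: "u \<in> carrier (monoid_alg (A \<times>\<times> B))" and v: "v \<in> carrier (monoid_alg (A \<times>\<times> B))"
    and uv: "u - v \<in> tensor_null A B"
  shows "tensor_null A B +>\<^bsub>monoid_alg (A \<times>\<times> B)\<^esub> u = tensor_null A B +>\<^bsub>monoid_alg (A \<times>\<times> B)\<^esub> v"
proof (rule P.a_repr_independence[symmetric])
  show "u \<in> tensor_null A B +>\<^bsub>monoid_alg (A \<times>\<times> B)\<^esub> v"
    unfolding a_r_coset_def'
    using uv by (force simp: monoid_alg_def)
qed (use v N.a_subgroup in auto)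

lemma pure_add_left:
  assumes "x \<in> carrier A" "x' \<in> carrier A" "y \<in> carrier B"
  shows "(x \<oplus>\<^bsub>A\<^esub> x') \<star> y = x \<star> y \<oplus>\<^bsub>T\<^esub> x' \<star> y"
proof -
  let ?e = "\<lambda>x y. Poly_Mapping.single (x, y) (1::'a)"
  have "x \<star> y \<oplus>\<^bsub>T\<^esub> x' \<star> y = tensor_null A B +>\<^bsub>monoid_alg (A \<times>\<times> B)\<^esub> (?e x y + ?e x' y)"
    using assms N.a_rcos_sum[of "?e x y" "?e x' y"] single_carrier
    by (simp add: tensor_def tensor_alg_def quot_alg_simps FactRing_def) (simp add: monoid_alg_def)
  also have "\<dots> = (x \<oplus>\<^bsub>A\<^esub> x') \<star> y"
    unfolding tensor_def
  proof (rule coset_eqI[symmetric])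
    show "?e x y + ?e x' y \<in> carrier (monoid_alg (A \<times>\<times> B))"
      using assms P.a_closed[OF single_carrier single_carrier, of x y x' y 1 1]
      by (simp add: monoid_alg_def)
    show "?e (x \<oplus>\<^bsub>A\<^esub> x') y - (?e x y + ?e x' y) \<in> tensor_null A B"
      unfolding diff_diff_eq[symmetric] using assms
      by (intro tensor_null_relator) (auto simp: bilinear_relators_def)
  qed (use assms in \<open>auto intro!: single_carrier\<close>)
  finally show ?thesis by simp
qed

lemma pure_add_right:
  assumes "x \<in> carrier A" "y \<in> carrier B" "y' \<in> carrier B"
  shows "x \<star> (y \<oplus>\<^bsub>B\<^esub> y') = x \<star> y \<oplus>\<^bsub>T\<^esub> x \<star> y'"
proof -
  let ?e = "\<lambda>x y. Poly_Mapping.single (x, y) (1::'a)"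
  have "x \<star> y \<oplus>\<^bsub>T\<^esub> x \<star> y' = tensor_null A B +>\<^bsub>monoid_alg (A \<times>\<times> B)\<^esub> (?e x y + ?e x y')"
    using assms N.a_rcos_sum[of "?e x y" "?e x y'"] single_carrier
    by (simp add: tensor_def tensor_alg_def quot_alg_simps FactRing_def) (simp add: monoid_alg_def)
  also have "\<dots> = x \<star> (y \<oplus>\<^bsub>B\<^esub> y')"
    unfolding tensor_def
  proof (rule coset_eqI[symmetric])
    show "?e x y + ?e x y' \<in> carrier (monoid_alg (A \<times>\<times> B))"
      using assms P.a_closed[OF single_carrier single_carrier, of x y x y' 1 1]
      by (simp add: monoid_alg_def)
    show "?e x (y \<oplus>\<^bsub>B\<^esub> y') - (?e x y + ?e x y') \<in> tensor_null A B"
      unfolding diff_diff_eq[symmetric] using assms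
      by (intro tensor_null_relator) (auto simp: bilinear_relators_def)
  qed (use assms in \<open>auto intro!: single_carrier\<close>)
  finally show ?thesis by simp
qed

lemma pure_smult:
  assumes "x \<in> carrier A" "y \<in> carrier B"
  shows "(c \<odot>\<^bsub>A\<^esub> x) \<star> y = c \<odot>\<^bsub>T\<^esub> (x \<star> y)" and "x \<star> (c \<odot>\<^bsub>B\<^esub> y) = c \<odot>\<^bsub>T\<^esub> (x \<star> y)"
proof -
  let ?e = "\<lambda>x y. Poly_Mapping.single (x, y) (1::'a)"
  have e: "c \<odot>\<^bsub>T\<^esub> (x \<star> y) = tensor_null A B +>\<^bsub>monoid_alg (A \<times>\<times> B)\<^esub> Poly_Mapping.single (x, y) c"
    using P.quot_alg_smult[OF N.ideal_axioms single_carrier[OF assms, of 1], of c]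
    by (simp add: tensor_def tensor_alg_def) (simp add: monoid_alg_def scale_single)
  show "(c \<odot>\<^bsub>A\<^esub> x) \<star> y = c \<odot>\<^bsub>T\<^esub> (x \<star> y)"
    unfolding e unfolding tensor_def using assms
    by (intro coset_eqI single_carrier tensor_null_relator A.smult_closed)
      (auto simp: bilinear_relators_def scale_single)
  show "x \<star> (c \<odot>\<^bsub>B\<^esub> y) = c \<odot>\<^bsub>T\<^esub> (x \<star> y)"
    unfolding e unfolding tensor_def using assms
    by (intro coset_eqI single_carrier tensor_null_relator B.smult_closed)
      (auto simp: bilinear_relators_def scale_single)
qed

lemma left_embedding: "(\<lambda>x. x \<star> \<one>\<^bsub>B\<^esub>) \<in> alg_hom A T"
  by (auto simp: alg_hom_def ring_hom_def pure_closed pure_mult pure_one pure_add_left pure_smult)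

lemma right_embedding: "(\<lambda>y. \<one>\<^bsub>A\<^esub> \<star> y) \<in> alg_hom B T"
  by (auto simp: alg_hom_def ring_hom_def pure_closed pure_mult pure_one pure_add_right pure_smult)

sublocale L: alg_homomorphism A T "\<lambda>x. x \<star> \<one>\<^bsub>B\<^esub>"
  by unfold_locales (rule left_embedding)

sublocale R: alg_homomorphism B T "\<lambda>y. \<one>\<^bsub>A\<^esub> \<star> y"
  by unfold_locales (rule right_embedding)

lemma pure_decomp:
  assumes "x \<in> carrier A" "y \<in> carrier B"
  shows "(x \<star> \<one>\<^bsub>B\<^esub>) \<otimes>\<^bsub>T\<^esub> (\<one>\<^bsub>A\<^esub> \<star> y) = x \<star> y" and "(\<one>\<^bsub>A\<^esub> \<star> y) \<otimes>\<^bsub>T\<^esub> (x \<star> \<one>\<^bsub>B\<^esub>) = x \<star> y"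
  using assms by (simp_all add: pure_mult)

end


section \<open>Alternating elements\<close>

lemma presented_gen_closed: "presented_gen R g \<in> carrier (presented_alg R)"
  using free_alg_carrier[of "free_gen g"]
  by (auto simp: presented_gen_def presented_alg_def quot_alg_simps FactRing_def A_RCOSETS_def')

lemma alt_closed [simp]:
  shows "alt_W q i \<in> carrier (U_alg q)" and "alt_G q n \<in> carrier (U_alg q)"
    and "alt_Gt q n \<in> carrier (U_alg q)"
proof (induction q i and q n and q n rule: alt_W_alt_G_alt_Gt.induct)
  interpret assoc_alg "U_alg q" for q :: 'a
    by (rule assoc_alg_U_alg)
  {
    case (1 q i)
    have "presented_gen (U_relations q) g \<in> carrier (U_alg q)" for g
      unfolding U_alg_def by (rule presented_gen_closed)
    with 1 show ?case
      by (subst alt_W.simps) (auto simp: Let_def smult_closed)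
  next
    case (2 q n)
    then show ?case
      by (subst alt_G.simps) (auto simp: Let_def
          intro!: smult_closed a_closed minus_closed finsum_closed m_closed)
  next
    case (3 q n)
    then show ?case
      by (subst alt_Gt.simps) (auto simp: Let_def
          intro!: smult_closed a_closed minus_closed finsum_closed m_closed)
  }
qed

lemma cal_closed [simp]:
  "cal_W q i \<in> carrier (cU_alg q)" "cal_G q n \<in> carrier (cU_alg q)" "cal_Gt q n \<in> carrier (cU_alg q)"
proof -
  interpret assoc_alg "cU_alg q" by (rule assoc_alg_cU_alg)
  have "presented_gen (cU_relations q) g \<in> carrier (cU_alg q)" for g
    unfolding cU_alg_def by (rule presented_gen_closed)
  then show "cal_W q i \<in> carrier (cU_alg q)" "cal_G q n \<in> carrier (cU_alg q)"
    "cal_Gt q n \<in> carrier (cU_alg q)"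
    by (simp_all add: cal_W_def cal_G_def cal_Gt_def)
qed

lemma z_closed [simp]: "z n \<in> carrier zpoly_alg"
  by (simp add: z_def zpoly_alg_def monoid_alg_def)

text \<open>
  Separate the extreme terms \<open>q\<^sup>n G~\<^sub>n\<close> and \<open>q\<^bsup>-n\<^esup> G\<^sub>n\<close> from the left-hand side and insert
  \<open>G~\<^sub>n = G\<^sub>n + f [W\<^sub>0, W\<^sub>n]\<close>. They add up to \<open>d G\<^sub>n + q\<^sup>n f [W\<^sub>0, W\<^sub>n]\<close> with \<open>d = q\<^sup>n + q\<^bsup>-n\<^esup>\<close>. The recursion for
  \<open>d G\<^sub>n\<close> contributes the right-hand side, minus the middle terms \<open>S\<close>, minus \<open>d e [W\<^sub>0, W\<^sub>n]\<close>; and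
  \<open>d e = q\<^sup>n f\<close>, so the commutators cancel.
\<close>

lemma alternating_quadratic_relation:
  fixes q :: "'a::field"
  assumes q: "q \<noteq> 0" "\<And>n::nat. n \<ge> 1 \<Longrightarrow> q ^ n \<noteq> 1" and n: "n \<ge> 1"
  shows "qconv (U_alg q) q (alt_G q) (alt_Gt q) n
    = qconv (U_alg q) q (\<lambda>k. alt_W q (- int k)) ((\<lambda>k. alt_W q (int k))(0 := \<zero>\<^bsub>U_alg q\<^esub>)) n"
proof -
  interpret assoc_alg "U_alg q" by (rule assoc_alg_U_alg)
  note closed = alt_closed[of q]
  define d where "d = q ^ n + inverse q ^ n"
  define e where "e = 1 / ((1 + inverse q ^ (2 * n)) * (1 - inverse q ^ 2))"
  define f where "f = 1 / (1 - inverse q ^ 2)"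
  define C where "C = alt_W q 0 \<otimes>\<^bsub>U_alg q\<^esub> alt_W q (int n) \<ominus>\<^bsub>U_alg q\<^esub> alt_W q (int n) \<otimes>\<^bsub>U_alg q\<^esub> alt_W q 0"
  define P where "P = qconv (U_alg q) q (\<lambda>k. alt_W q (- int k))
    ((\<lambda>k. alt_W q (int k))(0 := \<zero>\<^bsub>U_alg q\<^esub>)) n"
  define t where "t k = (q powi (int n - 2 * int k)) \<odot>\<^bsub>U_alg q\<^esub>
    (alt_G q k \<otimes>\<^bsub>U_alg q\<^esub> alt_Gt q (n - k))" for k
  define S where "S = (\<Oplus>\<^bsub>U_alg q\<^esub>k\<in>{1..<n}. t k)"
  let ?G = "alt_G q n" and ?Gt = "alt_Gt q n"
  have q2: "1 - inverse q ^ 2 \<noteq> 0"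
    using q(1) q(2)[of 2] by (auto simp: field_simps)
  \<comment> \<open>Otherwise \<open>q\<^bsup>2n\<^esup> = -1\<close>, and \<open>q\<^bsup>4n\<^esup> = 1\<close> makes \<open>q\<close> a root of unity.\<close>
  have q4: "1 + inverse q ^ (2 * n) \<noteq> 0"
  proof
    assume *: "1 + inverse q ^ (2 * n) = 0"
    have "q ^ (2 * n) * (1 + inverse q ^ (2 * n)) = q ^ (2 * n) + 1"
      using q(1) by (simp add: distrib_left flip: power_mult_distrib)
    with * have "q ^ (2 * n) = - 1"
      by (simp add: eq_neg_iff_add_eq_0)
    then have "q ^ (2 * n * 2) = 1"
      by (simp only: power_mult) simp
    with q(2)[of "2 * n * 2"] n show False by simp
  qed
  have d_eq: "d = q ^ n * (1 + inverse q ^ (2 * n))"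
  proof -
    have "q ^ n * inverse q ^ (2 * n) = inverse q ^ n * (q ^ n * inverse q ^ n)"
      unfolding mult_2 power_add by (simp only: ac_simps)
    also have "q ^ n * inverse q ^ n = 1"
      using q(1) by (simp flip: power_mult_distrib)
    finally show ?thesis
      by (simp add: d_def distrib_left)
  qed
  have d: "d \<noteq> 0" and de: "d * e = q ^ n * f"
    using q4 q2 q(1) by (simp_all add: d_eq e_def f_def)
  have c: "C \<in> carrier (U_alg q)" "P \<in> carrier (U_alg q)" "S \<in> carrier (U_alg q)"
    "\<And>k. t k \<in> carrier (U_alg q)"
    unfolding C_def P_def S_def t_def
    by (auto intro!: qconv_closed finsum_closed smult_closed minus_closed m_closed)
  have Gt: "?Gt = ?G \<oplus>\<^bsub>U_alg q\<^esub> f \<odot>\<^bsub>U_alg q\<^esub> C"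
    using n by (subst alt_Gt.simps) (simp add: Let_def f_def C_def)
  have P: "q \<odot>\<^bsub>U_alg q\<^esub> (\<Oplus>\<^bsub>U_alg q\<^esub>k\<in>{0..<n}. (q powi (int n - 1 - 2 * int k)) \<odot>\<^bsub>U_alg q\<^esub>
      (alt_W q (- int k) \<otimes>\<^bsub>U_alg q\<^esub> alt_W q (int n - int k))) = P"
    unfolding P_def
  proof (subst smult_finsum_shift[symmetric])
    show "q \<odot>\<^bsub>U_alg q\<^esub> (\<Oplus>\<^bsub>U_alg q\<^esub>k\<in>{0..<n}. (q powi (int n - 1 - 2 * int k)) \<odot>\<^bsub>U_alg q\<^esub>
        (alt_W q (- int k) \<otimes>\<^bsub>U_alg q\<^esub> alt_W q (int n - int k)))
      = q \<odot>\<^bsub>U_alg q\<^esub> (\<Oplus>\<^bsub>U_alg q\<^esub>k\<in>{0..<n}. (q powi (int n - 1 - 2 * int k)) \<odot>\<^bsub>U_alg q\<^esub>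
        (alt_W q (- int k) \<otimes>\<^bsub>U_alg q\<^esub> alt_W q (int (n - k))))"
      by (rule arg_cong[of _ _ "smult (U_alg q) q"], rule finsum_cong')
        (auto simp: of_nat_diff smult_closed)
  qed (use q in auto)
  have C': "alt_W q (int n) \<otimes>\<^bsub>U_alg q\<^esub> alt_W q 0 \<ominus>\<^bsub>U_alg q\<^esub> alt_W q 0 \<otimes>\<^bsub>U_alg q\<^esub> alt_W q (int n)
      = \<ominus>\<^bsub>U_alg q\<^esub> C"
    by (simp add: C_def minus_eq minus_add a_comm)
  have G: "?G = (1 / d) \<odot>\<^bsub>U_alg q\<^esub> (P \<ominus>\<^bsub>U_alg q\<^esub> S) \<oplus>\<^bsub>U_alg q\<^esub> e \<odot>\<^bsub>U_alg q\<^esub> (\<ominus>\<^bsub>U_alg q\<^esub> C)"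
    using n by (subst alt_G.simps) (simp add: Let_def P C' S_def t_def d_def e_def)
  have dG: "d \<odot>\<^bsub>U_alg q\<^esub> ?G = (P \<ominus>\<^bsub>U_alg q\<^esub> S) \<oplus>\<^bsub>U_alg q\<^esub> (q ^ n * f) \<odot>\<^bsub>U_alg q\<^esub> (\<ominus>\<^bsub>U_alg q\<^esub> C)"
    unfolding G using d by (simp add: c smult_add smult_closed smult_smult one_smult de)
  have "qconv (U_alg q) q (alt_G q) (alt_Gt q) n = t 0 \<oplus>\<^bsub>U_alg q\<^esub> (t n \<oplus>\<^bsub>U_alg q\<^esub> S)"
  proof -
    have "{..n} = insert 0 (insert n {1..<n})"
      using n by auto
    then show ?thesis
      unfolding qconv_def S_def t_def[symmetric] using n
      by (simp add: c Pi_def)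
  qed
  also have "t 0 = q ^ n \<odot>\<^bsub>U_alg q\<^esub> ?Gt"
    by (simp add: t_def alt_G.simps[of q 0])
  also have "t n = inverse q ^ n \<odot>\<^bsub>U_alg q\<^esub> ?G"
    by (simp add: t_def alt_Gt.simps[of q 0] power_int_minus power_inverse)
  also have "q ^ n \<odot>\<^bsub>U_alg q\<^esub> ?Gt \<oplus>\<^bsub>U_alg q\<^esub> (inverse q ^ n \<odot>\<^bsub>U_alg q\<^esub> ?G \<oplus>\<^bsub>U_alg q\<^esub> S)
      = d \<odot>\<^bsub>U_alg q\<^esub> ?G \<oplus>\<^bsub>U_alg q\<^esub> (q ^ n * f) \<odot>\<^bsub>U_alg q\<^esub> C \<oplus>\<^bsub>U_alg q\<^esub> S"
    unfolding Gt d_def by (simp add: c smult_add add_smult smult_closed smult_smult a_ac)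
  also have "\<dots> = P"
  proof -
    have "(q ^ n * f) \<odot>\<^bsub>U_alg q\<^esub> (\<ominus>\<^bsub>U_alg q\<^esub> C) \<oplus>\<^bsub>U_alg q\<^esub> (q ^ n * f) \<odot>\<^bsub>U_alg q\<^esub> C = \<zero>\<^bsub>U_alg q\<^esub>"
      by (simp add: c l_neg flip: smult_add)
    then show ?thesis
      unfolding dG by (simp add: c smult_closed minus_eq a_assoc l_neg)
  qed
  finally show ?thesis
    unfolding P_def .
qed

text \<open>
  The separate clause \<open>Z\<^sup>\<or>\<^sub>0 = 1\<close> needs no exception here, since the \<open>\<W>\<close>-part vanishes in degree \<open>0\<close>.
\<close>

lemma Z_check_eq_qconv:
  assumes q: "q \<noteq> 0"
  shows "Z_check q n = qconv (cU_alg q) q (cal_G q) (cal_Gt q) n \<ominus>\<^bsub>cU_alg q\<^esub>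
    qconv (cU_alg q) q (\<lambda>k. cal_W q (- int k)) ((\<lambda>k. cal_W q (int k))(0 := \<zero>\<^bsub>cU_alg q\<^esub>)) n"
proof -
  interpret assoc_alg "cU_alg q" by (rule assoc_alg_cU_alg)
  have W: "q \<odot>\<^bsub>cU_alg q\<^esub> (\<Oplus>\<^bsub>cU_alg q\<^esub>k\<in>{0..<n}. (q powi (int n - 1 - 2 * int k)) \<odot>\<^bsub>cU_alg q\<^esub>
      (cal_W q (- int k) \<otimes>\<^bsub>cU_alg q\<^esub> cal_W q (int n - int k)))
    = qconv (cU_alg q) q (\<lambda>k. cal_W q (- int k)) ((\<lambda>k. cal_W q (int k))(0 := \<zero>\<^bsub>cU_alg q\<^esub>)) n"
  proof (subst smult_finsum_shift[symmetric])
    show "q \<odot>\<^bsub>cU_alg q\<^esub> (\<Oplus>\<^bsub>cU_alg q\<^esub>k\<in>{0..<n}. (q powi (int n - 1 - 2 * int k)) \<odot>\<^bsub>cU_alg q\<^esub>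
        (cal_W q (- int k) \<otimes>\<^bsub>cU_alg q\<^esub> cal_W q (int n - int k)))
      = q \<odot>\<^bsub>cU_alg q\<^esub> (\<Oplus>\<^bsub>cU_alg q\<^esub>k\<in>{0..<n}. (q powi (int n - 1 - 2 * int k)) \<odot>\<^bsub>cU_alg q\<^esub>
        (cal_W q (- int k) \<otimes>\<^bsub>cU_alg q\<^esub> cal_W q (int (n - k))))"
      by (rule arg_cong[of _ _ "smult (cU_alg q) q"], rule finsum_cong')
        (auto simp: of_nat_diff smult_closed)
  qed (use q in auto)
  show ?thesis
  proof (cases "n = 0")
    case True
    then show ?thesis
      by (simp add: Z_check_def qconv_def cal_G_def cal_Gt_def one_smult minus_eq)
  next
    case False
    then show ?thesis
      unfolding W[symmetric] by (simp add: Z_check_def Let_def qconv_def atLeast0AtMost)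
  qed
qed

theorem lemma5p4:
  fixes q :: "'a::field"
    and n :: nat
    and \<phi> :: "'a cU \<Rightarrow> ('a U \<times> 'a zpoly \<Rightarrow>\<^sub>0 'a) set"
  assumes q_nonzero: "q \<noteq> 0"
    and q_not_root_of_unity: "\<And>n::nat. n \<ge> 1 \<Longrightarrow> q ^ n \<noteq> 1"
    and hom: "\<phi> \<in> alg_hom (cU_alg q) (UZ_alg q)"
    and W_minus: "\<And>n::nat. \<phi> (cal_W q (- int n)) =
      (\<Oplus>\<^bsub>UZ_alg q\<^esub>k\<in>{0..n}. UZ_tensor q (alt_W q (int k - int n)) (z k))"
    and W_plus: "\<And>n::nat. \<phi> (cal_W q (int n + 1)) =
      (\<Oplus>\<^bsub>UZ_alg q\<^esub>k\<in>{0..n}. UZ_tensor q (alt_W q (int n + 1 - int k)) (z k))"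
    and G: "\<And>n::nat. \<phi> (cal_G q n) =
      (\<Oplus>\<^bsub>UZ_alg q\<^esub>k\<in>{0..n}. UZ_tensor q (alt_G q (n - k)) (z k))"
    and Gt: "\<And>n::nat. \<phi> (cal_Gt q n) =
      (\<Oplus>\<^bsub>UZ_alg q\<^esub>k\<in>{0..n}. UZ_tensor q (alt_Gt q (n - k)) (z k))"
  shows "\<phi> (Z_check q n) = UZ_tensor q \<one>\<^bsub>U_alg q\<^esub> (z_check q n)"
proof -
  interpret U: assoc_alg "U_alg q" by (rule assoc_alg_U_alg)
  interpret Z: assoc_alg "zpoly_alg :: ('a, 'a zpoly) module" by (rule assoc_alg_zpoly_alg)
  interpret C: assoc_alg "cU_alg q" by (rule assoc_alg_cU_alg)
  interpret alg_pair "U_alg q" "zpoly_alg :: ('a, 'a zpoly) module" ..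
  interpret \<phi>: alg_homomorphism "cU_alg q" "UZ_alg q" \<phi>
    by unfold_locales (rule hom)
  define \<zeta> where "\<zeta> k = UZ_tensor q \<one>\<^bsub>U_alg q\<^esub> (z k)" for k
  let ?\<iota> = "\<lambda>u. UZ_tensor q u \<one>\<^bsub>zpoly_alg\<^esub>"
  let ?Wm = "\<lambda>k. alt_W q (- int k)" and ?Wp = "(\<lambda>k. alt_W q (int k))(0 := \<zero>\<^bsub>U_alg q\<^esub>)"
  let ?cWm = "\<lambda>k. cal_W q (- int k)" and ?cWp = "(\<lambda>k. cal_W q (int k))(0 := \<zero>\<^bsub>cU_alg q\<^esub>)"
  have \<zeta>_closed: "\<zeta> k \<in> carrier (UZ_alg q)" for k
    by (simp add: \<zeta>_def)
  have conv_\<zeta>: "conv (UZ_alg q) (\<lambda>k. ?\<iota> (x k)) \<zeta> k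
      = (\<Oplus>\<^bsub>UZ_alg q\<^esub>i\<in>{0..k}. UZ_tensor q (x (k - i)) (z i))"
    if "range x \<subseteq> carrier (U_alg q)" for x k
  proof -
    have c: "x i \<in> carrier (U_alg q)" for i
      using that by auto
    have "conv (UZ_alg q) (\<lambda>k. ?\<iota> (x k)) \<zeta> = conv (UZ_alg q) \<zeta> (\<lambda>k. ?\<iota> (x k))"
      by (rule T.conv_commute) (auto simp: c \<zeta>_def pure_decomp)
    then show ?thesis
      by (simp add: conv_def \<zeta>_def pure_decomp c atLeast0AtMost)
  qed
  have \<phi>G: "\<phi> (cal_G q k) = conv (UZ_alg q) (\<lambda>k. ?\<iota> (alt_G q k)) \<zeta> k" for k
    by (subst conv_\<zeta>) (auto simp: G)
  have \<phi>Gt: "\<phi> (cal_Gt q k) = conv (UZ_alg q) (\<lambda>k. ?\<iota> (alt_Gt q k)) \<zeta> k" for k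
    by (subst conv_\<zeta>) (auto simp: Gt)
  have \<phi>Wm: "\<phi> (?cWm k) = conv (UZ_alg q) (\<lambda>k. ?\<iota> (?Wm k)) \<zeta> k" for k
  proof -
    have "\<phi> (?cWm k) = (\<Oplus>\<^bsub>UZ_alg q\<^esub>i\<in>{0..k}. UZ_tensor q (?Wm (k - i)) (z i))"
      unfolding W_minus by (rule T.finsum_cong') (auto simp: of_nat_diff pure_closed)
    then show ?thesis
      by (subst conv_\<zeta>) auto
  qed
  \<comment> \<open>The convolution has one summand more than the prescribed value, which vanishes as \<open>W\<^sup>+\<^sub>0 = 0\<close>.\<close>
  have \<phi>Wp: "\<phi> (?cWp k) = conv (UZ_alg q) (\<lambda>k. ?\<iota> (?Wp k)) \<zeta> k" for k
  proof (cases k)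
    case 0
    then show ?thesis
      by (simp add: conv_def \<zeta>_closed)
  next
    case (Suc m)
    have "(\<Oplus>\<^bsub>UZ_alg q\<^esub>i\<in>{0..k}. UZ_tensor q (?Wp (k - i)) (z i))
        = (\<Oplus>\<^bsub>UZ_alg q\<^esub>i\<in>insert k {0..m}. UZ_tensor q (?Wp (k - i)) (z i))"
      using Suc by (simp add: atLeast0_atMost_Suc)
    also have "\<dots> = (\<Oplus>\<^bsub>UZ_alg q\<^esub>i\<in>{0..m}. UZ_tensor q (?Wp (k - i)) (z i))"
      using Suc pure_decomp[of "\<zero>\<^bsub>U_alg q\<^esub>" "z k"] by (subst T.finsum_insert) (auto simp: pure_closed)
    also have "\<dots> = (\<Oplus>\<^bsub>UZ_alg q\<^esub>i\<in>{0..m}. UZ_tensor q (alt_W q (int m + 1 - int i)) (z i))"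
      using Suc by (intro T.finsum_cong') (auto simp: pure_closed of_nat_diff add.commute)
    finally show ?thesis
      using Suc W_plus[of m] by (subst conv_\<zeta>) (auto simp: add.commute)
  qed
  have factor: "qconv (UZ_alg q) q
        (conv (UZ_alg q) (\<lambda>k. ?\<iota> (x k)) \<zeta>) (conv (UZ_alg q) (\<lambda>k. ?\<iota> (y k)) \<zeta>) n
      = conv (UZ_alg q) (\<lambda>k. ?\<iota> (qconv (U_alg q) q x y k)) (qconv (UZ_alg q) q \<zeta> \<zeta>) n"
    if "range x \<subseteq> carrier (U_alg q)" "range y \<subseteq> carrier (U_alg q)" for x y
  proof -
    have c: "x i \<in> carrier (U_alg q)" "y i \<in> carrier (U_alg q)" for i
      using that by auto
    show ?thesis
      by (subst T.qconv_interchange)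
        (auto simp: q_nonzero c \<zeta>_closed \<zeta>_def pure_decomp L.hom_qconv[OF that, abs_def])
  qed
  \<comment> \<open>The coefficients of \<open>G(q\<^sup>-\<^sup>1t) G~(qt) - W\<^sup>-(q\<^sup>-\<^sup>1t) W\<^sup>+(qt) = 1\<close>, viewed in the tensor product.\<close>
  define D where "D k = ?\<iota> (qconv (U_alg q) q (alt_G q) (alt_Gt q) k)
    \<ominus>\<^bsub>UZ_alg q\<^esub> ?\<iota> (qconv (U_alg q) q ?Wm ?Wp k)" for k
  have D: "D 0 = \<one>\<^bsub>UZ_alg q\<^esub>" "\<And>k. k > 0 \<Longrightarrow> D k = \<zero>\<^bsub>UZ_alg q\<^esub>"
  proof -
    show "D 0 = \<one>\<^bsub>UZ_alg q\<^esub>"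
      by (simp add: D_def qconv_def alt_G.simps[of q 0] alt_Gt.simps[of q 0] U.one_smult T.minus_eq)
    fix k :: nat assume "k > 0"
    then have "qconv (U_alg q) q (alt_G q) (alt_Gt q) k = qconv (U_alg q) q ?Wm ?Wp k"
      by (intro alternating_quadratic_relation q_nonzero q_not_root_of_unity) auto
    then show "D k = \<zero>\<^bsub>UZ_alg q\<^esub>"
      by (simp add: D_def T.minus_eq T.r_neg image_subset_iff)
  qed
  have "\<phi> (Z_check q n) = \<phi> (qconv (cU_alg q) q (cal_G q) (cal_Gt q) n)
      \<ominus>\<^bsub>UZ_alg q\<^esub> \<phi> (qconv (cU_alg q) q ?cWm ?cWp n)"
    by (simp add: Z_check_eq_qconv q_nonzero \<phi>.hom_minus image_subset_iff)
  also have "\<dots> = qconv (UZ_alg q) q (\<lambda>k. \<phi> (cal_G q k)) (\<lambda>k. \<phi> (cal_Gt q k)) n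
      \<ominus>\<^bsub>UZ_alg q\<^esub> qconv (UZ_alg q) q (\<lambda>k. \<phi> (?cWm k)) (\<lambda>k. \<phi> (?cWp k)) n"
    by (subst (1 2) \<phi>.hom_qconv) auto
  also have "\<dots> = conv (UZ_alg q)
        (\<lambda>k. ?\<iota> (qconv (U_alg q) q (alt_G q) (alt_Gt q) k)) (qconv (UZ_alg q) q \<zeta> \<zeta>) n
      \<ominus>\<^bsub>UZ_alg q\<^esub> conv (UZ_alg q)
        (\<lambda>k. ?\<iota> (qconv (U_alg q) q ?Wm ?Wp k)) (qconv (UZ_alg q) q \<zeta> \<zeta>) n"
    unfolding \<phi>G \<phi>Gt \<phi>Wm \<phi>Wp by (subst (1 2) factor) auto
  also have "\<dots> = conv (UZ_alg q) D (qconv (UZ_alg q) q \<zeta> \<zeta>) n"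
    unfolding D_def by (rule T.conv_minus_left) (auto simp: \<zeta>_closed image_subset_iff)
  also have "\<dots> = qconv (UZ_alg q) q \<zeta> \<zeta> n"
    by (rule T.conv_unit_left) (auto simp: D \<zeta>_closed image_subset_iff)
  also have "\<dots> = UZ_tensor q \<one>\<^bsub>U_alg q\<^esub> (qconv zpoly_alg q z z n)"
    unfolding \<zeta>_def by (rule R.hom_qconv[symmetric]) auto
  also have "qconv zpoly_alg q z z n = z_check q n"
    by (simp add: qconv_def z_check_def Let_def atLeast0AtMost)
  finally show ?thesis .
qed

end
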